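(* Let $\mathcal C$ be the real vector space of elasticity tensors on Euclidean $\mathbb R^3$, with the action of $SO(3,\mathbb R)$ and with the subspaces $\mathcal S,\mathcal A\subset\mathcal C$ as defined in the context. For $C\in\mathcal C$ let ${}^{(1)}C={}^{(1)}S$, ${}^{(2)}C={}^{(2)}S$, ${}^{(3)}C={}^{(3)}S$, ${}^{(4)}C={}^{(1)}A$, ${}^{(5)}C={}^{(2)}A$ be the tensors defined in the context, and for $I=1,\dots,5$ let ${}^{(I)}\mathcal C=\{{}^{(I)}C : C\in\mathcal C\}$. Then: (i) Each ${}^{(I)}\mathcal C$ is a linear subspace of $\mathcal C$, and every $C\in\mathcal C$ satisfies $$C_{ijkl}=\sum_{I=1}^5 {}^{(I)}C_{ijkl}=\left({}^{(1)}S_{ijkl}+{}^{(2)}S_{ijkl}+{}^{(3)}S_{ijkl}\right)+\left({}^{(1)}A_{ijkl}+{}^{(2)}A_{ijkl}\right).$$ (ii) This corresponds to the direct sum decomposition $$\mathcal C=\left({}^{(1)}\mathcal C\oplus{}^{(2)}\mathcal C\oplus{}^{(3)}\mathcal C\right)\oplus\left({}^{(4)}\mathcal C\oplus{}^{(5)}\mathcal C\right),$$ where ${}^{(1)}\mathcal C\oplus{}^{(2)}\mathcal C\oplus{}^{(3)}\mathcal C=\mathcal S$ and ${}^{(4)}\mathcal C\oplus{}^{(5)}\mathcal C=\mathcal A$, with respective dimensions $21=(1+5+9)+(1+5)$. (iii) Each ${}^{(I)}\mathcal C$ is invariant and irreducible under $SO(3,\mathbb R)$, and the decomposition is unique: up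 to order, it is the only decomposition of $\mathcal C$ as a direct sum of $SO(3,\mathbb R)$-irreducible subspaces each of which is contained in $\mathcal S$ or in $\mathcal A$. (iv) The pieces are mutually orthogonal: for every $C\in\mathcal C$ and all $I\neq J$, ${}^{(I)}C_{ijkl}\,{}^{(J)}C_{ijkl}=0$. (v) For every $C\in\mathcal C$, writing $C^2=C_{ijkl}C_{ijkl}$ and ${}^{(I)}C^2={}^{(I)}C_{ijkl}\,{}^{(I)}C_{ijkl}$, $$C^2=\left({}^{(1)}C^2+{}^{(2)}C^2+{}^{(3)}C^2\right)+\left({}^{(4)}C^2+{}^{(5)}C^2\right).$$
   Context: Indices run over $1,2,3$, rectangular (orthonormal) coordinates are used, so the metric is $g_{ij}=\delta_{ij}$ and upper and lower indices are not distinguished; repeated indices are summed. $\epsilon_{ijk}$ is the Levi-Civita symbol. The space $\mathcal C$ of elasticity tensors consists of all real arrays $C_{ijkl}$ with $C_{ijkl}=C_{jikl}=C_{klij}$ (hence also $C_{ijkl}=C_{ijlk}$). The group $SO(3,\mathbb R)$ acts by $(gC)_{ijkl}=g_{ia}g_{jb}g_{kc}g_{ld}C_{abcd}$. Permutation-group ($S_4$) decomposition: for $C\in\mathcal C$ let $$S_{ijkl}=C_{(ijkl)}=\tfrac13(C_{ijkl}+C_{iklj}+C_{iljk}),\qquad A_{ijkl}=C_{ijkl}-S_{ijkl}$$ (round brackets denote total symmetrization normalized to be a projection). $\mathcal S\subset\mathcal C$ is the subspace of totally symmetric tensors and $\mathcal A\subset\mathcal C$ is the subspace of those $C\in\mathcal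 C$ with $C_{(ijkl)}=0$. Pieces of $S$: put $S_{ij}=S_{ijkk}$, $S=S_{ii}$, $P_{ij}=S_{ij}-\frac13 S\,\delta_{ij}$ and define $${}^{(1)}S_{ijkl}=\tfrac1{15}S(\delta_{ij}\delta_{kl}+\delta_{ik}\delta_{jl}+\delta_{il}\delta_{jk}),$$ $${}^{(2)}S_{ijkl}=\tfrac17(P_{ij}\delta_{kl}+P_{ik}\delta_{jl}+P_{il}\delta_{jk}+P_{jk}\delta_{il}+P_{jl}\delta_{ik}+P_{kl}\delta_{ij}),$$ $${}^{(3)}S_{ijkl}=R_{ijkl}=S_{ijkl}-{}^{(1)}S_{ijkl}-{}^{(2)}S_{ijkl}.$$ Pieces of $A$: put $\Delta_{mn}=\frac13\epsilon_{mil}\epsilon_{njk}A_{ijkl}$, $A=\Delta_{mm}$ (a scalar), $Q_{ij}=\Delta_{ij}-\frac13A\,\delta_{ij}$ and define $${}^{(1)}A_{ijkl}=\tfrac16A(2\delta_{ij}\delta_{kl}-\delta_{il}\delta_{jk}-\delta_{ik}\delta_{jl}),\qquad {}^{(2)}A_{ijkl}=\tfrac12(\epsilon_{ikm}\epsilon_{jln}+\epsilon_{ilm}\epsilon_{jkn})Q_{mn}.$$ *)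

theory Defs
  imports "HOL-Analysis.Analysis" "HOL-Combinatorics.Permutations"
begin

text \<open>
  The component $T_{ijkl}$ of a tensor of rank four on Euclidean 3-space, with respect to
  rectangular coordinates, is \<open>T $ i $ j $ k $ l\<close>. In the numeral type \<open>3\<close> the indices
  are 1, 2 and 3 (the last one being equal to 0).
\<close>

type_synonym tensor4 = "real^3^3^3^3"

definition kronecker :: "3 \<Rightarrow> 3 \<Rightarrow> real" where
  "kronecker i j = (if i = j then 1 else 0)"

definition levi_civita :: "3 \<Rightarrow> 3 \<Rightarrow> 3 \<Rightarrow> real" where
  "levi_civita i j k =
     (if (i, j, k) \<in> {(1, 2, 3), (2, 3, 1), (3, 1, 2)} then 1
      else if (i, j, k) \<in> {(3, 2, 1), (2, 1, 3), (1, 3, 2)} then - 1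
      else 0)"

text \<open>The inner product of the library on \<^typ>\<open>tensor4\<close> is the full contraction.\<close>

lemma inner_tensor4:
  fixes T U :: tensor4
  shows "T \<bullet> U =
    (\<Sum>i\<in>UNIV. \<Sum>j\<in>UNIV. \<Sum>k\<in>UNIV. \<Sum>l\<in>UNIV. T $ i $ j $ k $ l * U $ i $ j $ k $ l)"
  by (simp add: inner_vec_def)

definition SO3 :: "(real^3^3) set" where
  "SO3 = {g. rotation_matrix g}"

definition act :: "real^3^3 \<Rightarrow> tensor4 \<Rightarrow> tensor4" where
  "act g T = (\<chi> i j k l. \<Sum>a\<in>UNIV. \<Sum>b\<in>UNIV. \<Sum>c\<in>UNIV. \<Sum>d\<in>UNIV.
     g $ i $ a * g $ j $ b * g $ k $ c * g $ l $ d * T $ a $ b $ c $ d)"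

definition SO3_invariant :: "tensor4 set \<Rightarrow> bool" where
  "SO3_invariant W \<longleftrightarrow> (\<forall>g\<in>SO3. \<forall>T\<in>W. act g T \<in> W)"

definition SO3_irreducible :: "tensor4 set \<Rightarrow> bool" where
  "SO3_irreducible W \<longleftrightarrow> subspace W \<and> SO3_invariant W \<and> W \<noteq> {0} \<and>
     (\<forall>U. subspace U \<and> U \<subseteq> W \<and> SO3_invariant U \<longrightarrow> U = {0} \<or> U = W)"

text \<open>\<open>internal_direct_sum I W V\<close>: the space \<open>V\<close> is the internal direct sum of the
  finite family of subspaces \<open>W i\<close>, \<open>i \<in> I\<close>.\<close>

definition internal_direct_sum :: "'i set \<Rightarrow> ('i \<Rightarrow> 'a::real_vector set) \<Rightarrow> 'a set \<Rightarrow> bool" where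
  "internal_direct_sum I W V \<longleftrightarrow>
     finite I \<and> (\<forall>i\<in>I. subspace (W i)) \<and>
     V = {(\<Sum>i\<in>I. w i) | w. \<forall>i\<in>I. w i \<in> W i} \<and>
     (\<forall>w. (\<forall>i\<in>I. w i \<in> W i) \<and> (\<Sum>i\<in>I. w i) = 0 \<longrightarrow> (\<forall>i\<in>I. w i = 0))"

definition elasticity :: "tensor4 set" where
  "elasticity = {C. \<forall>i j k l. C $ i $ j $ k $ l = C $ j $ i $ k $ l \<and>
                              C $ i $ j $ k $ l = C $ k $ l $ i $ j}"

definition permute_indices :: "(nat \<Rightarrow> nat) \<Rightarrow> tensor4 \<Rightarrow> tensor4" where
  "permute_indices p T = (\<chi> i j k l.
     T $ ([i, j, k, l] ! p 0) $ ([i, j, k, l] ! p 1) $ ([i, j, k, l] ! p 2) $ ([i, j, k, l] ! p 3))"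

definition symmetrize :: "tensor4 \<Rightarrow> tensor4" where
  "symmetrize T = (1 / fact 4) *\<^sub>R (\<Sum>p | p permutes {..<4}. permute_indices p T)"

definition totally_symmetric :: "tensor4 \<Rightarrow> bool" where
  "totally_symmetric T \<longleftrightarrow> (\<forall>p. p permutes {..<4} \<longrightarrow> permute_indices p T = T)"

definition sym_space :: "tensor4 set" where
  "sym_space = {C \<in> elasticity. totally_symmetric C}"

definition asym_space :: "tensor4 set" where
  "asym_space = {C \<in> elasticity. symmetrize C = 0}"

definition S_part :: "tensor4 \<Rightarrow> tensor4" where
  "S_part C = symmetrize C"

definition A_part :: "tensor4 \<Rightarrow> tensor4" where
  "A_part C = C - S_part C"

text \<open>The argument \<open>S\<close> is the symmetric part of an elasticity tensor.\<close>

definition S_trace2 :: "tensor4 \<Rightarrow> 3 \<Rightarrow> 3 \<Rightarrow> real" where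
  "S_trace2 S i j = (\<Sum>k\<in>UNIV. S $ i $ j $ k $ k)"

definition S_scalar :: "tensor4 \<Rightarrow> real" where
  "S_scalar S = (\<Sum>i\<in>UNIV. S_trace2 S i i)"

definition P_tensor :: "tensor4 \<Rightarrow> 3 \<Rightarrow> 3 \<Rightarrow> real" where
  "P_tensor S i j = S_trace2 S i j - 1 / 3 * S_scalar S * kronecker i j"

definition S1 :: "tensor4 \<Rightarrow> tensor4" where
  "S1 S = (\<chi> i j k l. 1 / 15 * S_scalar S *
     (kronecker i j * kronecker k l + kronecker i k * kronecker j l + kronecker i l * kronecker j k))"

definition S2 :: "tensor4 \<Rightarrow> tensor4" where
  "S2 S = (\<chi> i j k l. 1 / 7 *
     (P_tensor S i j * kronecker k l + P_tensor S i k * kronecker j l + P_tensor S i l * kronecker j k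
      + P_tensor S j k * kronecker i l + P_tensor S j l * kronecker i k + P_tensor S k l * kronecker i j))"

definition S3 :: "tensor4 \<Rightarrow> tensor4" where
  "S3 S = S - S1 S - S2 S"

text \<open>The argument \<open>A\<close> is the difference of an elasticity tensor and its symmetric part.\<close>

definition Delta :: "tensor4 \<Rightarrow> 3 \<Rightarrow> 3 \<Rightarrow> real" where
  "Delta A m n = 1 / 3 * (\<Sum>i\<in>UNIV. \<Sum>j\<in>UNIV. \<Sum>k\<in>UNIV. \<Sum>l\<in>UNIV.
     levi_civita m i l * levi_civita n j k * A $ i $ j $ k $ l)"

definition A_scalar :: "tensor4 \<Rightarrow> real" where
  "A_scalar A = (\<Sum>m\<in>UNIV. Delta A m m)"

definition Q_tensor :: "tensor4 \<Rightarrow> 3 \<Rightarrow> 3 \<Rightarrow> real" where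
  "Q_tensor A i j = Delta A i j - 1 / 3 * A_scalar A * kronecker i j"

definition A1 :: "tensor4 \<Rightarrow> tensor4" where
  "A1 A = (\<chi> i j k l. 1 / 6 * A_scalar A *
     (2 * kronecker i j * kronecker k l - kronecker i l * kronecker j k - kronecker i k * kronecker j l))"

definition A2 :: "tensor4 \<Rightarrow> tensor4" where
  "A2 A = (\<chi> i j k l. 1 / 2 * (\<Sum>m\<in>UNIV. \<Sum>n\<in>UNIV.
     (levi_civita i k m * levi_civita j l n + levi_civita i l m * levi_civita j k n) * Q_tensor A m n))"

text \<open>Only the indices 1 to 5 are meaningful.\<close>

definition piece :: "nat \<Rightarrow> tensor4 \<Rightarrow> tensor4" where
  "piece I C =
     (if I = 1 then S1 (S_part C)
      else if I = 2 then S2 (S_part C)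
      else if I = 3 then S3 (S_part C)
      else if I = 4 then A1 (A_part C)
      else if I = 5 then A2 (A_part C)
      else 0)"

definition piece_space :: "nat \<Rightarrow> tensor4 set" where
  "piece_space I = {piece I C | C. C \<in> elasticity}"

definition irreducible_SA_decomposition :: "nat \<Rightarrow> (nat \<Rightarrow> tensor4 set) \<Rightarrow> bool" where
  "irreducible_SA_decomposition n W \<longleftrightarrow>
     internal_direct_sum {1..n} W elasticity \<and>
     (\<forall>i\<in>{1..n}. SO3_irreducible (W i) \<and> (W i \<subseteq> sym_space \<or> W i \<subseteq> asym_space))"

lemma subspace_elasticity: "subspace elasticity"
proof (rule subspaceI)
  show "0 \<in> elasticity" by (simp add: elasticity_def)
  show "x + y \<in> elasticity" if "x \<in> elasticity" "y \<in> elasticity" for x y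
    using that unfolding elasticity_def mem_Collect_eq vector_add_component by metis
  show "c *\<^sub>R x \<in> elasticity" if "x \<in> elasticity" for c x
    using that unfolding elasticity_def mem_Collect_eq vector_scaleR_component by metis
qed

lemma SO3_invariant_elasticity: "SO3_invariant elasticity"
proof -
  have "act g T $ i $ j $ k $ l = act g T $ j $ i $ k $ l \<and>
        act g T $ i $ j $ k $ l = act g T $ k $ l $ i $ j"
    if T: "T \<in> elasticity" for g T i j k l
  proof
    have T1: "T $ a $ b $ c $ d = T $ b $ a $ c $ d"
      and T2: "T $ a $ b $ c $ d = T $ c $ d $ a $ b" for a b c d
      using T unfolding elasticity_def by blast+
    have "act g T $ j $ i $ k $ l = (\<Sum>a\<in>UNIV. \<Sum>b\<in>UNIV. \<Sum>c\<in>UNIV. \<Sum>d\<in>UNIV.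
        g $ i $ b * g $ j $ a * g $ k $ c * g $ l $ d * T $ b $ a $ c $ d)"
      unfolding act_def vec_lambda_beta
      by (intro sum.cong refl) (subst T1, simp add: mult_ac)
    also have "\<dots> = act g T $ i $ j $ k $ l"
      unfolding act_def vec_lambda_beta by (rule sum.swap)
    finally show "act g T $ i $ j $ k $ l = act g T $ j $ i $ k $ l" by simp
    have "act g T $ k $ l $ i $ j = (\<Sum>a\<in>UNIV. \<Sum>b\<in>UNIV. \<Sum>c\<in>UNIV. \<Sum>d\<in>UNIV.
        g $ i $ c * g $ j $ d * g $ k $ a * g $ l $ b * T $ c $ d $ a $ b)"
      unfolding act_def vec_lambda_beta
      by (intro sum.cong refl) (subst T2, simp add: mult_ac)
    also have "\<dots> = act g T $ i $ j $ k $ l"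
      unfolding act_def vec_lambda_beta sum.cartesian_product
      by (rule sum.reindex_bij_witness[where i = "\<lambda>(c, d, a, b). (a, b, c, d)"
            and j = "\<lambda>(a, b, c, d). (c, d, a, b)"]) auto
    finally show "act g T $ i $ j $ k $ l = act g T $ k $ l $ i $ j" by simp
  qed
  then show ?thesis
    unfolding SO3_invariant_def elasticity_def by blast
qed

lemma symmetrize_elasticity:
  assumes "C \<in> elasticity"
  shows "symmetrize C $ i $ j $ k $ l =
    1 / 3 * (C $ i $ j $ k $ l + C $ i $ k $ l $ j + C $ i $ l $ j $ k)"
proof -
  have C1: "C $ a $ b $ c $ d = C $ b $ a $ c $ d"
    and C2: "C $ a $ b $ c $ d = C $ c $ d $ a $ b" for a b c d
    using assms unfolding elasticity_def by blast+
  have C3: "C $ a $ b $ c $ d = C $ a $ b $ d $ c" for a b c d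
    using C1 C2 by metis
  have 4: "{..<4} = insert 0 (insert 1 (insert 2 (insert 3 ({} :: nat set))))" by auto
  have e:
    "C $ b $ a $ c $ d = C $ a $ b $ c $ d"
    "C $ a $ b $ d $ c = C $ a $ b $ c $ d"
    "C $ b $ a $ d $ c = C $ a $ b $ c $ d"
    "C $ c $ d $ a $ b = C $ a $ b $ c $ d"
    "C $ d $ c $ a $ b = C $ a $ b $ c $ d"
    "C $ c $ d $ b $ a = C $ a $ b $ c $ d"
    "C $ d $ c $ b $ a = C $ a $ b $ c $ d" for a b c d
    using C1 C2 C3 by metis+
  show ?thesis
    unfolding symmetrize_def 4
    apply (simp add: sum_over_permutations_insert permute_indices_def transpose_def fact_numeral)
    using e[of i j k l] e[of i k l j] e[of i l j k] by linarith
qed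

end

theory Submission
  imports Defs
begin

text \<open>
  Expanding products of two Levi-Civita symbols into Kronecker symbols, the pieces 1, 2, 4, 5 are
  seen to be the images of the scalar or of the symmetric traceless matrices under equivariant
  linear maps, and piece 3 is the orthogonal complement of pieces 1 and 2 in the totally
  symmetric tensors.

  Irreducibility of the pieces 1, 2, 3: for a nonzero invariant subspace \<open>U\<close>, the projection of
  \<open>e\<^sub>3 \<otimes> e\<^sub>3 \<otimes> e\<^sub>3 \<otimes> e\<^sub>3\<close> to \<open>U\<close> is fixed by the rotations about the third axis, and it is nonzero since
  the quartic form of a tensor in \<open>U\<close> does not vanish on the whole unit sphere. In each piece such
  fixed vectors form a line, so \<open>U\<close> and its orthogonal complement cannot both be nonzero.

  Uniqueness: irreducible subspaces that are not orthogonal have the same dimension. As the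
  dimensions 1, 5, 9 and 1, 5 are distinct, an irreducible subspace of the symmetric or of the
  asymmetric tensors is orthogonal to all pieces of that space but one, hence equal to that one.
\<close>

subsection \<open>Orthogonal direct sums\<close>

text \<open>Pieces 1 and 4 are isomorphic as representations of the rotation group, and so are
  pieces 2 and 5; the graphs of such isomorphisms give infinitely many other decompositions of
  \<open>elasticity\<close> into irreducible subspaces. Confining each summand to
  \<open>sym_space\<close> or \<open>asym_space\<close> is what restores uniqueness, and on either
  side the dimension alone then tells the pieces apart. The projection argument cannot treat pieces
  4 and 5, because the component 3333 of every tensor in \<open>asym_space\<close> vanishes. Their
  irreducibility is carried over from pieces 1 and 2 instead: all four are parametrized, through
  \<open>mat_tensor\<close> with different weights, by symmetric matrices on which a rotation acts
  by conjugation.\<close>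

lemma internal_direct_sum_orthogonal:
  fixes W :: "'i \<Rightarrow> 'a::real_inner set"
  assumes "finite I" and V: "subspace V" and W: "\<And>i. i \<in> I \<Longrightarrow> subspace (W i) \<and> W i \<subseteq> V"
    and orth: "\<And>i j x y. \<lbrakk>i \<in> I; j \<in> I; i \<noteq> j; x \<in> W i; y \<in> W j\<rbrakk> \<Longrightarrow> x \<bullet> y = 0"
    and ex: "\<And>v. v \<in> V \<Longrightarrow> \<exists>w. (\<forall>i\<in>I. w i \<in> W i) \<and> v = (\<Sum>i\<in>I. w i)"
  shows "internal_direct_sum I W V"
proof -
  have "w j = 0" if w: "\<forall>i\<in>I. w i \<in> W i" and s: "(\<Sum>i\<in>I. w i) = 0" and j: "j \<in> I" for w j
  proof -
    have "0 = (\<Sum>i\<in>I. w i \<bullet> w j)"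
      using s by (simp flip: inner_sum_left)
    also have "\<dots> = (\<Sum>i\<in>I. if i = j then w j \<bullet> w j else 0)"
      using orth w j by (intro sum.cong) auto
    also have "\<dots> = w j \<bullet> w j"
      using j \<open>finite I\<close> by simp
    finally show ?thesis by simp
  qed
  moreover have "V = {(\<Sum>i\<in>I. w i) | w. \<forall>i\<in>I. w i \<in> W i}"
    using ex W by (fastforce intro: subspace_sum[OF V])
  ultimately show ?thesis
    using W \<open>finite I\<close> unfolding internal_direct_sum_def by blast
qed

lemma dim_UN_orthogonal:
  fixes W :: "'i \<Rightarrow> 'a::euclidean_space set"
  assumes "finite I"
    and "\<And>i j x y. \<lbrakk>i \<in> I; j \<in> I; i \<noteq> j; x \<in> W i; y \<in> W j\<rbrakk> \<Longrightarrow> x \<bullet> y = 0"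
  shows "dim (\<Union>i\<in>I. W i) = (\<Sum>i\<in>I. dim (W i))"
  using assms
proof (induction I)
  case (insert i I)
  have "dim (W i \<union> (\<Union>j\<in>I. W j)) = dim (W i) + dim (\<Union>j\<in>I. W j)"
  proof (rule dim_orthogonal_sum)
    fix x y assume x: "x \<in> W i" and "y \<in> (\<Union>j\<in>I. W j)"
    then obtain j where "j \<in> I" "y \<in> W j" by blast
    then show "x \<bullet> y = 0"
      using x insert.hyps by (intro insert.prems[of i j]) auto
  qed
  moreover have "dim (\<Union>j\<in>I. W j) = (\<Sum>j\<in>I. dim (W j))"
    by (rule insert.IH) (use insert.prems in auto)
  ultimately show ?case using insert.hyps by simp
qed simp

lemma dim_internal_direct_sum_orthogonal:
  fixes W :: "'i \<Rightarrow> 'a::euclidean_space set"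
  assumes ds: "internal_direct_sum I W V"
    and orth: "\<And>i j x y. \<lbrakk>i \<in> I; j \<in> I; i \<noteq> j; x \<in> W i; y \<in> W j\<rbrakk> \<Longrightarrow> x \<bullet> y = 0"
  shows "dim V = (\<Sum>i\<in>I. dim (W i))"
proof -
  have fin: "finite I" and sub: "\<And>i. i \<in> I \<Longrightarrow> subspace (W i)"
    and V: "V = {(\<Sum>i\<in>I. w i) | w. \<forall>i\<in>I. w i \<in> W i}"
    using ds unfolding internal_direct_sum_def by blast+
  have "W i \<subseteq> V" if "i \<in> I" for i
  proof
    fix x assume "x \<in> W i"
    then have "x = (\<Sum>j\<in>I. if j = i then x else 0)" "\<forall>j\<in>I. (if j = i then x else 0) \<in> W j"
      using that fin sub by (simp_all add: subspace_0)
    then show "x \<in> V" unfolding V mem_Collect_eq by (intro exI conjI)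
  qed
  then have 1: "(\<Union>i\<in>I. W i) \<subseteq> V" by blast
  have "w i \<in> span (\<Union>i\<in>I. W i)" if "\<forall>i\<in>I. w i \<in> W i" "i \<in> I" for w i
    using that by (intro span_base) blast
  then have 2: "V \<subseteq> span (\<Union>i\<in>I. W i)"
    unfolding V by (auto intro!: span_sum)
  have "dim V = dim (\<Union>i\<in>I. W i)"
    using dim_subset[OF 1] dim_subset[OF 2] by simp
  also have "\<dots> = (\<Sum>i\<in>I. dim (W i))"
    by (rule dim_UN_orthogonal[OF fin]) (rule orth)
  finally show ?thesis .
qed

text \<open>The indicator vectors of the fibres form an orthogonal basis.\<close>

lemma dim_constant_on_fibres:
  fixes e :: "'n::finite \<Rightarrow> 'a::euclidean_space" and \<kappa> :: "'n \<Rightarrow> 'c"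
  assumes e: "bij_betw e UNIV Basis"
  shows "dim {x. \<forall>p q. \<kappa> p = \<kappa> q \<longrightarrow> x \<bullet> e p = x \<bullet> e q} = card (range \<kappa>)" (is "dim ?V = _")
proof -
  define B where "B c = (\<Sum>p | \<kappa> p = c. e p)" for c
  have ee: "e p \<bullet> e q = (if p = q then 1 else 0)" for p q
  proof -
    have "e p \<in> Basis" "e q \<in> Basis"
      using bij_betwE[OF e] by simp_all
    moreover have "e p = e q \<longleftrightarrow> p = q"
      by (rule inj_eq) (use e in \<open>simp add: bij_betw_def\<close>)
    ultimately show ?thesis by (simp add: inner_Basis)
  qed
  have Be: "B c \<bullet> e q = (if \<kappa> q = c then 1 else 0)" for c q
    unfolding B_def inner_sum_left ee by simp
  have Bne: "B (\<kappa> q) \<noteq> 0" for q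
    using Be[of "\<kappa> q" q] by auto
  have BB: "B c \<bullet> B d = 0" if "c \<noteq> d" for c d
  proof -
    have "B c \<bullet> B d = (\<Sum>p | \<kappa> p = d. B c \<bullet> e p)"
      unfolding B_def[of d] by (rule inner_sum_right)
    also have "\<dots> = 0"
      using that by (intro sum.neutral) (auto simp: Be)
    finally show ?thesis .
  qed
  have inj: "inj_on B (range \<kappa>)"
  proof (rule inj_onI)
    fix c d assume "c \<in> range \<kappa>" and eq: "B c = B d"
    then obtain p where "c = \<kappa> p" by blast
    show "c = d"
    proof (rule ccontr)
      assume "c \<noteq> d"
      then have "B c \<bullet> B c = 0" using BB[of c d] eq by simp
      then show False using Bne[of p] \<open>c = \<kappa> p\<close> by simp
    qed
  qed
  have "independent (B ` range \<kappa>)"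
  proof (rule pairwise_orthogonal_independent)
    show "pairwise orthogonal (B ` range \<kappa>)"
      unfolding pairwise_image
      by (rule pairwiseI) (use BB in \<open>auto simp: orthogonal_def\<close>)
    show "0 \<notin> B ` range \<kappa>"
    proof
      assume "0 \<in> B ` range \<kappa>"
      then obtain q where "0 = B (\<kappa> q)" by blast
      then show False using Bne[of q] by simp
    qed
  qed
  moreover have "B ` range \<kappa> \<subseteq> ?V"
    by (rule image_subsetI) (simp add: Be)
  moreover have "?V \<subseteq> span (B ` range \<kappa>)"
  proof
    fix x assume x: "x \<in> ?V"
    \<comment> \<open>The common value of \<open>x\<close> on the fibre over \<open>c\<close>, read
      off at an arbitrary point of it.\<close>
    define f where "f c = x \<bullet> e (SOME p. \<kappa> p = c)" for c
    have f: "f (\<kappa> p) = x \<bullet> e p" for p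
    proof -
      have "\<kappa> (SOME q. \<kappa> q = \<kappa> p) = \<kappa> p"
        by (rule someI) (rule refl)
      then show ?thesis unfolding f_def using x by blast
    qed
    have xe: "x \<bullet> e p = (\<Sum>c\<in>range \<kappa>. f c *\<^sub>R B c) \<bullet> e p" for p
    proof -
      have "(\<Sum>c\<in>range \<kappa>. f c *\<^sub>R B c) \<bullet> e p = (\<Sum>c\<in>range \<kappa>. if c = \<kappa> p then f c else 0)"
        unfolding inner_sum_left by (intro sum.cong refl) (simp add: Be)
      also have "\<dots> = f (\<kappa> p)"
        by (subst sum.delta) simp_all
      finally show ?thesis by (simp only: f)
    qed
    have "x \<bullet> b = (\<Sum>c\<in>range \<kappa>. f c *\<^sub>R B c) \<bullet> b" if "b \<in> Basis" for b
    proof -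
      have "b \<in> range e"
        using bij_betw_imp_surj_on[OF e] that by simp
      then obtain p where "b = e p" ..
      then show ?thesis by (simp only: xe)
    qed
    then have "x = (\<Sum>c\<in>range \<kappa>. f c *\<^sub>R B c)"
      by (rule euclidean_eqI)
    also have "\<dots> \<in> span (B ` range \<kappa>)"
      by (intro span_sum span_scale span_base imageI)
    finally show "x \<in> span (B ` range \<kappa>)" .
  qed
  ultimately have "dim ?V = card (B ` range \<kappa>)"
    using dim_unique by blast
  then show ?thesis by (simp only: card_image[OF inj])
qed

text \<open>The set is a singleton if \<open>a = b\<close> and a two-element subset otherwise. Used
  twice for the dimension 21: 3 indices give 6 unordered pairs, and 6 pairs give 21 pairs of
  pairs.\<close>

lemma card_doubletons:
  assumes "finite D"
  shows "card {{a, b} | a b. a \<in> D \<and> b \<in> D} = card D + (card D choose 2)"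
proof -
  have "{{a, b} | a b. a \<in> D \<and> b \<in> D} = (\<lambda>a. {a}) ` D \<union> {B. B \<subseteq> D \<and> card B = 2}"
    by (force simp: card_2_iff)
  moreover have "(\<lambda>a. {a}) ` D \<inter> {B. B \<subseteq> D \<and> card B = 2} = {}"
    by auto
  ultimately show ?thesis
    using assms by (simp add: card_Un_disjoint card_image n_subsets)
qed

subsection \<open>The action of the rotation group\<close>

text \<open>The adjacent transpositions generate all permutations of the four slots, so a map that
  commutes with these three respects every index symmetry.\<close>

definition swap12 :: "tensor4 \<Rightarrow> tensor4" where
  "swap12 T = (\<chi> i j k l. T $ j $ i $ k $ l)"

definition swap23 :: "tensor4 \<Rightarrow> tensor4" where
  "swap23 T = (\<chi> i j k l. T $ i $ k $ j $ l)"

definition swap34 :: "tensor4 \<Rightarrow> tensor4" where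
  "swap34 T = (\<chi> i j k l. T $ i $ j $ l $ k)"

lemma act_nth: "act g T $ i $ j $ k $ l = (\<Sum>a\<in>UNIV. \<Sum>b\<in>UNIV. \<Sum>c\<in>UNIV. \<Sum>d\<in>UNIV.
     g $ i $ a * g $ j $ b * g $ k $ c * g $ l $ d * T $ a $ b $ c $ d)"
  by (simp add: act_def)

lemma act_swap12: "act g (swap12 T) = swap12 (act g T)"
  by (simp add: vec_eq_iff act_nth swap12_def) (subst sum.swap, simp add: mult_ac)

lemma act_swap23: "act g (swap23 T) = swap23 (act g T)"
  by (simp add: vec_eq_iff act_nth swap23_def) (subst (2) sum.swap, simp add: mult_ac)

lemma act_swap34: "act g (swap34 T) = swap34 (act g T)"
  by (simp add: vec_eq_iff act_nth swap34_def) (subst (3) sum.swap, simp add: mult_ac)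

lemma linear_act: "linear (act g)"
  by (rule linearI) (simp_all add: vec_eq_iff act_nth sum.distrib distrib_left sum_distrib_left mult_ac)

lemma act_add: "act g (x + y) = act g x + act g y"
  and act_scaleR: "act g (c *\<^sub>R x) = c *\<^sub>R act g x"
  by (simp_all add: linear_add linear_scale linear_act)

text \<open>Serves \<open>act_adjoint\<close>: the four sums of the contraction pass the four sums
  of the action in a single reindexing of eight-tuples.\<close>

lemma sum_swap4:
  "(\<Sum>i\<in>I. \<Sum>j\<in>J. \<Sum>k\<in>K. \<Sum>l\<in>L. \<Sum>a\<in>A. \<Sum>b\<in>B. \<Sum>c\<in>C. \<Sum>d\<in>D. F i j k l a b c d) =
   (\<Sum>a\<in>A. \<Sum>b\<in>B. \<Sum>c\<in>C. \<Sum>d\<in>D. \<Sum>i\<in>I. \<Sum>j\<in>J. \<Sum>k\<in>K. \<Sum>l\<in>L. F i j k l a b c d)"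
  unfolding sum.cartesian_product
  by (rule sum.reindex_bij_witness[where i = "\<lambda>(a, b, c, d, i, j, k, l). (i, j, k, l, a, b, c, d)"
        and j = "\<lambda>(i, j, k, l, a, b, c, d). (a, b, c, d, i, j, k, l)"]) clarsimp+

text \<open>One eightfold sum, read from either end. As \<open>SO3\<close> is closed under
  transposition, orthogonal complements of invariant subspaces are invariant.\<close>

lemma act_adjoint: "act g T \<bullet> U = T \<bullet> act (transpose g) U"
  unfolding inner_tensor4 act_nth sum_distrib_left sum_distrib_right
  by (rule trans[OF sum_swap4]) (simp add: transpose_def mult_ac)

lemma SO3_transpose: "g \<in> SO3 \<Longrightarrow> transpose g \<in> SO3"
  by (simp add: SO3_def rotation_matrix_def orthogonal_matrix_transpose)

text \<open>Invariance of the metric; it is why the Kronecker factors of a tensor survive the action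
  unchanged.\<close>

lemma SO3_rows:
  assumes "g \<in> SO3"
  shows "(\<Sum>a\<in>UNIV. g $ i $ a * g $ j $ a) = kronecker i j"
proof -
  have "g ** transpose g = mat 1"
    using assms by (simp add: SO3_def rotation_matrix_def orthogonal_matrix_def)
  then have "(g ** transpose g) $ i $ j = (mat 1 :: real^3^3) $ i $ j" by simp
  then show ?thesis
    by (simp add: matrix_matrix_mult_def transpose_def mat_def kronecker_def)
qed

subsection \<open>Symmetrization\<close>

lemma elasticityD:
  assumes "C \<in> elasticity"
  shows "C $ j $ i $ k $ l = C $ i $ j $ k $ l" "C $ i $ j $ l $ k = C $ i $ j $ k $ l"
    "C $ k $ l $ i $ j = C $ i $ j $ k $ l"
  using assms unfolding elasticity_def mem_Collect_eq by metis+

text \<open>The order is \<open>q \<circ> p\<close> because \<open>p\<close> selects from the list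
  that \<open>q\<close> has already rearranged. That list has length four, so its entries are
  accessed only at positions below 4.\<close>

lemma permute_indices_compose:
  assumes "p permutes {..<4}" "q permutes {..<4}"
  shows "permute_indices q (permute_indices p T) = permute_indices (q \<circ> p) T"
proof -
  have "[x ! q 0, x ! q 1, x ! q 2, x ! q 3] ! n = x ! q n" if "n < 4" for n and x :: "3 list"
  proof -
    have "n = 0 \<or> n = 1 \<or> n = 2 \<or> n = 3" using that by linarith
    then show ?thesis by auto
  qed
  moreover have "p n < 4" if "n < 4" for n
    using permutes_in_image[OF assms(1), of n] that by simp
  ultimately show ?thesis
    by (simp add: permute_indices_def vec_eq_iff)
qed

lemma permute_indices_symmetrize:
  assumes "q permutes {..<4}"
  shows "permute_indices q (symmetrize T) = symmetrize T"
proof -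
  have "permute_indices q (symmetrize T) =
      (1 / fact 4) *\<^sub>R (\<Sum>p | p permutes {..<4}. permute_indices q (permute_indices p T))"
    by (simp add: symmetrize_def vec_eq_iff permute_indices_def[of q] sum_component)
  also have "\<dots> = (1 / fact 4) *\<^sub>R (\<Sum>p | p permutes {..<4}. permute_indices (q \<circ> p) T)"
    using assms by (simp add: permute_indices_compose)
  also have "\<dots> = symmetrize T"
    unfolding symmetrize_def using setum_permutations_compose_left[OF assms, of "\<lambda>p. permute_indices p T"]
    by simp
  finally show ?thesis .
qed

text \<open>On \<open>elasticity\<close> the average over 24 permutations collapses to the three
  ways of pairing the indices, and the middle swap makes these three terms equal.\<close>

lemma symmetrize_id:
  assumes "T \<in> elasticity" "\<And>i j k l. T $ i $ k $ j $ l = T $ i $ j $ k $ l"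
  shows "symmetrize T = T"
  unfolding vec_eq_iff
proof (intro allI)
  fix i j k l
  show "symmetrize T $ i $ j $ k $ l = T $ i $ j $ k $ l"
    using elasticityD(2)[OF assms(1), of i k l j] elasticityD(2)[OF assms(1), of i j l k] assms(2)[of i k j l]
      assms(2)[of i l j k]
    by (simp add: symmetrize_elasticity[OF assms(1)])
qed

text \<open>Swaps within the first and within the last pair come with \<open>elasticity\<close>, so
  the middle swap completes a set of generators. For the backward direction no permutation is
  factored into swaps: \<open>T\<close> equals its own average, and averages are invariant.\<close>

lemma sym_space_iff:
  "T \<in> sym_space \<longleftrightarrow> T \<in> elasticity \<and> (\<forall>i j k l. T $ i $ k $ j $ l = T $ i $ j $ k $ l)"
proof
  assume T: "T \<in> sym_space"
  \<comment> \<open>Positions are counted from 0, so this exchanges the second and the third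
    index.\<close>
  have "Transposition.transpose 1 2 permutes {..<4::nat}"
    by (rule permutes_swap_id) auto
  then have "permute_indices (Transposition.transpose 1 2) T = T"
    using T by (simp add: sym_space_def totally_symmetric_def)
  then have "permute_indices (Transposition.transpose 1 2) T $ i $ j $ k $ l = T $ i $ j $ k $ l" for i j k l
    by simp
  then show "T \<in> elasticity \<and> (\<forall>i j k l. T $ i $ k $ j $ l = T $ i $ j $ k $ l)"
    using T by (simp add: sym_space_def permute_indices_def Transposition.transpose_def)
next
  assume T: "T \<in> elasticity \<and> (\<forall>i j k l. T $ i $ k $ j $ l = T $ i $ j $ k $ l)"
  then have "symmetrize T = T" by (intro symmetrize_id) auto
  then show "T \<in> sym_space"
    using T permute_indices_symmetrize[of _ T] by (simp add: sym_space_def totally_symmetric_def)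
qed

lemma sym_spaceD:
  assumes "T \<in> sym_space"
  shows "T $ j $ i $ k $ l = T $ i $ j $ k $ l" "T $ i $ k $ j $ l = T $ i $ j $ k $ l"
    "T $ i $ j $ l $ k = T $ i $ j $ k $ l"
  using assms elasticityD[of T] by (simp_all add: sym_space_iff)

text \<open>The three terms of the symmetrization belong to the three pairings of four indices, and
  permuting the indices only permutes the pairings.\<close>

lemma S_part_in_sym_space:
  assumes "C \<in> elasticity"
  shows "S_part C \<in> sym_space"
proof -
  note C = elasticityD[OF assms]
  have "S_part C \<in> elasticity"
    unfolding elasticity_def S_part_def symmetrize_elasticity[OF assms] mem_Collect_eq
  proof (intro allI conjI)
    fix i j k l
    show "1 / 3 * (C $ i $ j $ k $ l + C $ i $ k $ l $ j + C $ i $ l $ j $ k) =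
          1 / 3 * (C $ j $ i $ k $ l + C $ j $ k $ l $ i + C $ j $ l $ i $ k)"
      by (simp add: C(1)[of j i k l] C(2)[of j k l i] C(3)[of j k i l] C(3)[of j l i k] C(2)[of i k j l])
    show "1 / 3 * (C $ i $ j $ k $ l + C $ i $ k $ l $ j + C $ i $ l $ j $ k) =
          1 / 3 * (C $ k $ l $ i $ j + C $ k $ i $ j $ l + C $ k $ j $ l $ i)"
      by (simp add: C(3)[of k l i j] C(1)[of k i j l] C(2)[of i k j l] C(1)[of k j l i] C(2)[of j k l i] C(3)[of j k i l])
  qed
  moreover have "S_part C $ i $ k $ j $ l = S_part C $ i $ j $ k $ l" for i j k l
    unfolding S_part_def symmetrize_elasticity[OF assms]
    using C(2)[of i k j l] C(2)[of i j k l] C(2)[of i l k j] by simp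
  ultimately show ?thesis by (simp add: sym_space_iff)
qed

lemma S_part_sym_space: "T \<in> sym_space \<Longrightarrow> S_part T = T"
  unfolding S_part_def by (rule symmetrize_id) (simp_all add: sym_space_iff)

lemma asym_space_iff:
  "T \<in> asym_space \<longleftrightarrow>
    T \<in> elasticity \<and> (\<forall>i j k l. T $ i $ j $ k $ l + T $ i $ k $ l $ j + T $ i $ l $ j $ k = 0)"
  by (auto simp: asym_space_def vec_eq_iff symmetrize_elasticity)

lemma S_part_asym_space: "T \<in> asym_space \<Longrightarrow> S_part T = 0"
  by (simp add: asym_space_def S_part_def)

lemma subspace_sym_space: "subspace sym_space"
proof (rule subspaceI)
  show "0 \<in> sym_space" by (simp add: sym_space_iff subspace_0[OF subspace_elasticity])
  show "x + y \<in> sym_space" if "x \<in> sym_space" "y \<in> sym_space" for x y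
    using that by (simp add: sym_space_iff subspace_add[OF subspace_elasticity])
  show "c *\<^sub>R x \<in> sym_space" if "x \<in> sym_space" for c x
    using that by (simp add: sym_space_iff subspace_scale[OF subspace_elasticity])
qed

lemma subspace_asym_space: "subspace asym_space"
proof (rule subspaceI)
  show "0 \<in> asym_space" by (simp add: asym_space_iff subspace_0[OF subspace_elasticity])
  show "x + y \<in> asym_space" if "x \<in> asym_space" "y \<in> asym_space" for x y
  proof -
    have "(x + y) $ i $ j $ k $ l + (x + y) $ i $ k $ l $ j + (x + y) $ i $ l $ j $ k =
        (x $ i $ j $ k $ l + x $ i $ k $ l $ j + x $ i $ l $ j $ k) +
        (y $ i $ j $ k $ l + y $ i $ k $ l $ j + y $ i $ l $ j $ k)" for i j k l
      by simp
    then show ?thesis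
      using that by (simp only: asym_space_iff subspace_add[OF subspace_elasticity]) simp
  qed
  show "c *\<^sub>R x \<in> asym_space" if "x \<in> asym_space" for c x
    using that by (simp add: asym_space_iff subspace_scale[OF subspace_elasticity] flip: distrib_left)
qed

lemma A_part_in_asym_space:
  assumes "C \<in> elasticity"
  shows "A_part C \<in> asym_space"
proof -
  have S: "S_part C \<in> sym_space" by (rule S_part_in_sym_space[OF assms])
  have "S_part C \<in> elasticity" using S by (simp add: sym_space_iff)
  then have "A_part C \<in> elasticity"
    unfolding A_part_def by (intro subspace_diff[OF subspace_elasticity] assms)
  moreover have "A_part C $ i $ j $ k $ l + A_part C $ i $ k $ l $ j + A_part C $ i $ l $ j $ k = 0" for i j k l
    by (simp add: A_part_def S_part_def symmetrize_elasticity[OF assms] field_simps)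
  ultimately show ?thesis by (simp add: asym_space_iff)
qed

lemma A_part_asym_space: "T \<in> asym_space \<Longrightarrow> A_part T = T"
  by (simp add: A_part_def S_part_asym_space)

text \<open>Within \<open>elasticity\<close> the space is the fixed space of \<open>swap23\<close>,
  which commutes with the action.\<close>

lemma SO3_invariant_sym_space: "SO3_invariant sym_space"
proof -
  have "act g T \<in> sym_space" if "T \<in> sym_space" "g \<in> SO3" for g T
  proof -
    have "swap23 T = T"
      using that by (simp add: swap23_def vec_eq_iff sym_space_iff)
    then have "swap23 (act g T) = act g T" by (simp flip: act_swap23)
    then have "act g T $ i $ k $ j $ l = act g T $ i $ j $ k $ l" for i j k l
      by (simp add: swap23_def vec_eq_iff)
    then show ?thesis
      using that SO3_invariant_elasticity by (simp add: sym_space_iff SO3_invariant_def)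
  qed
  then show ?thesis by (simp add: SO3_invariant_def)
qed

subsection \<open>Tensors built from a symmetric matrix\<close>

definition outer_kronecker :: "real^3^3 \<Rightarrow> tensor4" where
  "outer_kronecker M = (\<chi> i j k l. M $ i $ j * kronecker k l)"

text \<open>The two weights separate the terms with \<open>M\<close> on an index pair 12 or 34 from
  those that mix the pairs. In the cyclic sum that defines \<open>asym_space\<close> each product of
  \<open>M\<close> and a Kronecker symbol occurs once with weight \<open>a\<close> and twice with
  weight \<open>b\<close>. For symmetric \<open>M\<close> the result is therefore totally symmetric
  if \<open>a = b\<close> and asymmetric if \<open>a + 2 * b = 0\<close>, whence the weights (1, 1)
  and (2, -1) below.\<close>

definition mat_tensor :: "real \<Rightarrow> real \<Rightarrow> real^3^3 \<Rightarrow> tensor4" where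
  "mat_tensor a b M = (\<chi> i j k l.
     a * (M $ i $ j * kronecker k l + M $ k $ l * kronecker i j) +
     b * (M $ i $ k * kronecker j l + M $ i $ l * kronecker j k
        + M $ j $ k * kronecker i l + M $ j $ l * kronecker i k))"

lemma mat_tensor_nth: "mat_tensor a b M $ i $ j $ k $ l =
     a * (M $ i $ j * kronecker k l + M $ k $ l * kronecker i j) +
     b * (M $ i $ k * kronecker j l + M $ i $ l * kronecker j k
        + M $ j $ k * kronecker i l + M $ j $ l * kronecker i k)"
  by (simp add: mat_tensor_def)

text \<open>All six terms are permuted copies of one tensor, so equivariance and inner products need
  computing only for \<open>outer_kronecker\<close>.\<close>

lemma mat_tensor_outer_kronecker:
  "mat_tensor a b M =
    a *\<^sub>R (outer_kronecker M + swap23 (swap12 (swap34 (swap23 (outer_kronecker M))))) +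
    b *\<^sub>R (swap23 (outer_kronecker M) + swap34 (swap23 (outer_kronecker M)) +
      swap12 (swap23 (outer_kronecker M)) + swap12 (swap34 (swap23 (outer_kronecker M))))"
  by (simp add: vec_eq_iff mat_tensor_nth outer_kronecker_def swap12_def swap23_def swap34_def)

lemma linear_mat_tensor: "linear (mat_tensor a b)"
  by (rule linearI) (simp_all add: vec_eq_iff mat_tensor_nth algebra_simps)

lemma kronecker_commute: "kronecker i j = kronecker j i"
  by (simp add: kronecker_def)

definition sym_matrices :: "(real^3^3) set" where
  "sym_matrices = {M. \<forall>i j. M $ j $ i = M $ i $ j}"

definition sym_traceless :: "(real^3^3) set" where
  "sym_traceless = {M \<in> sym_matrices. trace M = 0}"

lemma sym_matricesD: "M \<in> sym_matrices \<Longrightarrow> M $ j $ i = M $ i $ j"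
  by (simp add: sym_matrices_def)

text \<open>The rotation conjugates \<open>M\<close> in the first two slots and fixes the Kronecker
  symbol in the last two.\<close>

lemma act_outer_kronecker:
  assumes "g \<in> SO3"
  shows "act g (outer_kronecker M) = outer_kronecker (g ** M ** transpose g)"
proof -
  have "act g (outer_kronecker M) $ i $ j $ k $ l =
      outer_kronecker (g ** M ** transpose g) $ i $ j $ k $ l" for i j k l
  proof -
    have "act g (outer_kronecker M) $ i $ j $ k $ l =
      (\<Sum>a\<in>UNIV. \<Sum>b\<in>UNIV. g $ i $ a * g $ j $ b * M $ a $ b *
         (\<Sum>c\<in>UNIV. \<Sum>d\<in>UNIV. g $ k $ c * g $ l $ d * kronecker c d))"
      by (simp add: act_nth outer_kronecker_def sum_distrib_left mult_ac)
    also have "(\<Sum>c\<in>UNIV. \<Sum>d\<in>UNIV. g $ k $ c * g $ l $ d * kronecker c d) = kronecker k l"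
      by (simp add: kronecker_def[of _ _] if_distrib SO3_rows[OF assms, unfolded kronecker_def] cong: if_cong)
    also have "(\<Sum>a\<in>UNIV. \<Sum>b\<in>UNIV. g $ i $ a * g $ j $ b * M $ a $ b * kronecker k l) =
      (g ** M ** transpose g) $ i $ j * kronecker k l"
      by (subst sum.swap) (simp add: matrix_matrix_mult_def transpose_def sum_distrib_right sum_distrib_left mult_ac)
    finally show ?thesis by (simp add: outer_kronecker_def)
  qed
  then show ?thesis by (simp add: vec_eq_iff)
qed

lemma act_mat_tensor:
  assumes "g \<in> SO3"
  shows "act g (mat_tensor a b M) = mat_tensor a b (g ** M ** transpose g)"
  unfolding mat_tensor_outer_kronecker
  by (simp add: act_add act_scaleR act_swap12 act_swap23 act_swap34 act_outer_kronecker[OF assms])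

lemma conj_sym_matrices:
  assumes "M \<in> sym_matrices"
  shows "g ** M ** transpose g \<in> sym_matrices"
proof -
  have "transpose M = M"
    using assms by (simp add: sym_matrices_def transpose_def vec_eq_iff)
  then have "transpose (g ** M ** transpose g) = g ** M ** transpose g"
    by (simp add: matrix_transpose_mul matrix_mul_assoc)
  then show ?thesis
    by (simp add: sym_matrices_def transpose_def vec_eq_iff)
qed

lemma trace_conj:
  assumes "g \<in> SO3"
  shows "trace (g ** M ** transpose g) = trace M"
proof -
  have "trace (g ** M ** transpose g) = trace (transpose g ** (g ** M))"
    by (rule trace_mul_sym)
  also have "\<dots> = trace M"
    using assms by (simp add: matrix_mul_assoc SO3_def rotation_matrix_def orthogonal_matrix_def)
  finally show ?thesis .
qed

lemma conj_mat_1: "g \<in> SO3 \<Longrightarrow> g ** mat 1 ** transpose g = mat 1"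
  by (simp add: SO3_def rotation_matrix_def orthogonal_matrix_def)

lemma mat_tensor_elasticity:
  assumes "M \<in> sym_matrices"
  shows "mat_tensor a b M \<in> elasticity"
  using sym_matricesD[OF assms]
  by (simp add: elasticity_def mat_tensor_nth kronecker_commute algebra_simps)

lemma mat_tensor_sym_space:
  assumes "M \<in> sym_matrices"
  shows "mat_tensor a a M \<in> sym_space"
  using sym_matricesD[OF assms]
  by (simp add: sym_space_iff mat_tensor_elasticity[OF assms] mat_tensor_nth kronecker_commute algebra_simps)

lemma mat_tensor_asym_space:
  assumes "M \<in> sym_matrices"
  shows "mat_tensor 2 (- 1) M \<in> asym_space"
  using sym_matricesD[OF assms]
  by (simp add: asym_space_iff mat_tensor_elasticity[OF assms] mat_tensor_nth kronecker_commute algebra_simps)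

lemma mat_1_sym_matrices [simp]: "mat 1 \<in> sym_matrices"
  by (simp add: sym_matrices_def mat_def)

lemma subspace_sym_matrices: "subspace sym_matrices"
  by (simp add: sym_matrices_def subspace_def)

lemma sym_traceless_subset: "sym_traceless \<subseteq> sym_matrices"
  by (auto simp: sym_traceless_def)

lemma trace_scaleR: "trace (c *\<^sub>R M) = c * trace (M :: real^'n^'n)"
  by (simp add: trace_def sum_distrib_left)

lemma subspace_sym_traceless: "subspace sym_traceless"
  using subspace_sym_matrices
  by (simp add: sym_traceless_def subspace_def trace_add trace_scaleR) (simp add: trace_def)

definition deviator :: "real^3^3 \<Rightarrow> real^3^3" where
  "deviator M = M - (trace M / 3) *\<^sub>R mat 1"

lemma deviator_sym_traceless: "M \<in> sym_matrices \<Longrightarrow> deviator M \<in> sym_traceless"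
  by (simp add: sym_traceless_def deviator_def subspace_diff subspace_scale subspace_sym_matrices
      trace_sub trace_scaleR trace_I)

lemma deviator_id: "M \<in> sym_traceless \<Longrightarrow> deviator M = M"
  by (simp add: sym_traceless_def deviator_def)

lemma mat_tensor_split:
  "mat_tensor a b M = mat_tensor a b ((trace M / 3) *\<^sub>R mat 1) + mat_tensor a b (deviator M)"
  by (simp add: deviator_def flip: linear_add[OF linear_mat_tensor])

section \<open>Traces and the pieces of a totally symmetric tensor\<close>

lemma mat_1_nth: "(mat 1 :: real^3^3) $ i $ j = kronecker i j"
  by (simp add: mat_def kronecker_def)

text \<open>Contracting the last two indices, the Kronecker symbol on them gives 3, the other term
  of weight \<open>a\<close> gives the trace of \<open>M\<close>, and each of the four mixed terms
  gives \<open>M\<close> itself.\<close>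

lemma S_trace2_mat_tensor:
  assumes "M \<in> sym_matrices"
  shows "S_trace2 (mat_tensor a b M) i j = (3 * a + 4 * b) * M $ i $ j + a * trace M * kronecker i j"
proof -
  have "\<forall>i j. S_trace2 (mat_tensor a b M) i j = (3 * a + 4 * b) * M $ i $ j + a * trace M * kronecker i j"
    using sym_matricesD[OF assms, of 1 2] sym_matricesD[OF assms, of 1 3] sym_matricesD[OF assms, of 2 3]
    by (simp add: forall_3 S_trace2_def sum_3 mat_tensor_nth kronecker_def trace_def algebra_simps)
  then show ?thesis by blast
qed

lemma S_scalar_mat_tensor:
  assumes "M \<in> sym_matrices"
  shows "S_scalar (mat_tensor a b M) = (6 * a + 4 * b) * trace M"
  by (simp add: S_scalar_def S_trace2_mat_tensor[OF assms] sum_3 trace_def kronecker_def algebra_simps)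

text \<open>The constant 30 is \<open>S_scalar (mat_tensor 1 1 (mat 1))\<close>; it is twice 15
  since each product of Kronecker symbols occurs twice in that tensor.\<close>

lemma S1_eq_mat_tensor: "S1 S = mat_tensor 1 1 ((S_scalar S / 30) *\<^sub>R mat 1)"
  by (simp add: S1_def vec_eq_iff mat_tensor_nth mat_1_nth algebra_simps)

text \<open>The constant 7 is \<open>3 * a + 4 * b\<close> for weights (1, 1): the factor by which
  the double trace of \<open>mat_tensor\<close> scales a traceless matrix.\<close>

lemma S2_eq_mat_tensor: "S2 S = mat_tensor 1 1 ((1 / 7) *\<^sub>R (\<chi> i j. P_tensor S i j))"
  by (simp add: S2_def vec_eq_iff mat_tensor_nth algebra_simps)

lemma S1_mat_tensor:
  assumes "M \<in> sym_matrices"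
  shows "S1 (mat_tensor 1 1 M) = mat_tensor 1 1 ((trace M / 3) *\<^sub>R mat 1)"
  by (simp add: S1_eq_mat_tensor S_scalar_mat_tensor[OF assms])

lemma S2_mat_tensor:
  assumes "M \<in> sym_matrices"
  shows "S2 (mat_tensor 1 1 M) = mat_tensor 1 1 (deviator M)"
proof -
  have "(1 / 7) *\<^sub>R (\<chi> i j. P_tensor (mat_tensor 1 1 M) i j) = deviator M"
    by (simp add: vec_eq_iff P_tensor_def S_trace2_mat_tensor[OF assms] S_scalar_mat_tensor[OF assms]
        deviator_def mat_1_nth field_simps)
  then show ?thesis by (simp add: S2_eq_mat_tensor)
qed

lemma P_tensor_sym_traceless:
  assumes "S \<in> sym_space"
  shows "(\<chi> i j. P_tensor S i j) \<in> sym_traceless"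
proof -
  have "P_tensor S j i = P_tensor S i j" for i j
    using sym_spaceD(1)[OF assms] by (simp add: P_tensor_def S_trace2_def kronecker_commute)
  moreover have "(\<Sum>i\<in>UNIV. P_tensor S i i) = 0"
    by (simp add: P_tensor_def S_scalar_def sum_3 kronecker_def field_simps)
  ultimately show ?thesis
    by (simp add: sym_traceless_def sym_matrices_def trace_def)
qed

lemma S_trace2_add: "S_trace2 (T + U) i j = S_trace2 T i j + S_trace2 U i j"
  and S_trace2_diff: "S_trace2 (T - U) i j = S_trace2 T i j - S_trace2 U i j"
  and S_trace2_scaleR: "S_trace2 (c *\<^sub>R T) i j = c * S_trace2 T i j"
  and S_trace2_0: "S_trace2 0 i j = 0"
  by (simp_all add: S_trace2_def sum.distrib sum_subtractf sum_distrib_left)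

text \<open>By total symmetry, one vanishing trace makes all of them vanish. In terms of quartic
  forms these are the harmonic ones.\<close>

definition traceless_sym_space :: "tensor4 set" where
  "traceless_sym_space = {T \<in> sym_space. \<forall>i j. S_trace2 T i j = 0}"

lemma subspace_traceless_sym_space: "subspace traceless_sym_space"
  using subspace_sym_space
  by (simp add: traceless_sym_space_def subspace_def S_trace2_0 S_trace2_add S_trace2_scaleR)

lemma S1_in: "S1 S \<in> mat_tensor 1 1 ` span {mat 1}"
  unfolding S1_eq_mat_tensor by (intro imageI span_scale span_base) simp

lemma S2_in: "S \<in> sym_space \<Longrightarrow> S2 S \<in> mat_tensor 1 1 ` sym_traceless"
  unfolding S2_eq_mat_tensor
  by (intro imageI subspace_scale[OF subspace_sym_traceless] P_tensor_sym_traceless)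

lemma span_mat_1_subset: "span {mat 1} \<subseteq> sym_matrices"
  by (rule span_minimal) (simp_all add: subspace_sym_matrices)

text \<open>The double trace of \<open>S1 S\<close> is the trace part of \<open>S_trace2 S\<close>
  and that of \<open>S2 S\<close> is its traceless part, so subtracting both leaves trace
  zero.\<close>

lemma S3_in:
  assumes "S \<in> sym_space"
  shows "S3 S \<in> traceless_sym_space"
proof -
  have "S1 S \<in> sym_space" "S2 S \<in> sym_space"
    using S1_in[of S] S2_in[OF assms] span_mat_1_subset sym_traceless_subset mat_tensor_sym_space
    by (metis (no_types, lifting) imageE subsetD)+
  then have "S3 S \<in> sym_space"
    unfolding S3_def by (intro subspace_diff[OF subspace_sym_space] assms)
  moreover have "S_trace2 (S3 S) i j = 0" for i j
  proof -
    define P where "P = (\<chi> i j. P_tensor S i j)"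
    have P: "P \<in> sym_matrices" "trace P = 0"
      using P_tensor_sym_traceless[OF assms] by (simp_all add: P_def sym_traceless_def)
    have "S_trace2 (S1 S) i j = S_scalar S / 3 * kronecker i j"
      unfolding S1_eq_mat_tensor
      by (subst S_trace2_mat_tensor)
        (simp_all add: subspace_scale[OF subspace_sym_matrices] trace_scaleR trace_I mat_1_nth)
    moreover have "S_trace2 (S2 S) i j = P $ i $ j"
      unfolding S2_eq_mat_tensor P_def[symmetric]
      by (subst S_trace2_mat_tensor)
        (simp_all add: subspace_scale[OF subspace_sym_matrices] trace_scaleR P)
    ultimately show ?thesis
      by (simp add: S3_def S_trace2_diff P_def P_tensor_def)
  qed
  ultimately show ?thesis by (simp add: traceless_sym_space_def)
qed

lemma S3_traceless:
  assumes "S \<in> traceless_sym_space"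
  shows "S3 S = S"
proof -
  have "S_scalar S = 0" "P_tensor S i j = 0" for i j
    using assms by (simp_all add: traceless_sym_space_def P_tensor_def S_scalar_def)
  then have "S1 S = 0" "S2 S = 0"
    by (simp_all add: S1_def S2_def vec_eq_iff)
  then show ?thesis by (simp add: S3_def)
qed

section \<open>Levi-Civita contractions and the pieces of an asymmetric tensor\<close>

lemma Delta_mat_tensor:
  assumes "M \<in> sym_matrices"
  shows "Delta (mat_tensor 2 (- 1) M) m n = - 2 * M $ m $ n + 2 * trace M * kronecker m n"
proof -
  have "\<forall>m n. Delta (mat_tensor 2 (- 1) M) m n = - 2 * M $ m $ n + 2 * trace M * kronecker m n"
    using sym_matricesD[OF assms, of 1 2] sym_matricesD[OF assms, of 1 3] sym_matricesD[OF assms, of 2 3]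
    by (simp add: forall_3 Delta_def sum_3 levi_civita_def mat_tensor_nth kronecker_def trace_def algebra_simps)
  then show ?thesis by blast
qed

lemma A_scalar_mat_tensor:
  assumes "M \<in> sym_matrices"
  shows "A_scalar (mat_tensor 2 (- 1) M) = 4 * trace M"
  by (simp add: A_scalar_def Delta_mat_tensor[OF assms] sum_3 trace_def kronecker_def algebra_simps)

lemma Q_tensor_mat_tensor:
  assumes "M \<in> sym_matrices"
  shows "Q_tensor (mat_tensor 2 (- 1) M) i j = - 2 * deviator M $ i $ j"
  by (simp add: Q_tensor_def Delta_mat_tensor[OF assms] A_scalar_mat_tensor[OF assms] deviator_def
      mat_1_nth field_simps)

lemma A1_mat_tensor:
  assumes "M \<in> sym_matrices"
  shows "A1 (mat_tensor 2 (- 1) M) = mat_tensor 2 (- 1) ((trace M / 3) *\<^sub>R mat 1)"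
  by (simp add: A1_def A_scalar_mat_tensor[OF assms] vec_eq_iff mat_tensor_nth mat_1_nth field_simps)

text \<open>The product of two Levi-Civita symbols is a 3 by 3 determinant of Kronecker symbols. Two
  of its six terms contract to the trace of \<open>N\<close> and vanish, the other four remain. The
  proof checks all 81 index choices.\<close>

lemma levi_civita_contraction:
  assumes "N \<in> sym_traceless"
  shows "(\<Sum>m\<in>UNIV. \<Sum>n\<in>UNIV. levi_civita i k m * levi_civita j l n * N $ m $ n) =
    kronecker i l * N $ j $ k + kronecker j k * N $ i $ l - kronecker i j * N $ k $ l - kronecker k l * N $ i $ j"
proof -
  have N: "N \<in> sym_matrices" and tr: "N $ 1 $ 1 + N $ 2 $ 2 + N $ 3 $ 3 = 0"
    using assms by (simp_all add: sym_traceless_def trace_def sum_3)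
  have "\<forall>i j k l. (\<Sum>m\<in>UNIV. \<Sum>n\<in>UNIV. levi_civita i k m * levi_civita j l n * N $ m $ n) =
    kronecker i l * N $ j $ k + kronecker j k * N $ i $ l - kronecker i j * N $ k $ l - kronecker k l * N $ i $ j"
    using tr sym_matricesD[OF N, of 1 2] sym_matricesD[OF N, of 1 3] sym_matricesD[OF N, of 2 3]
    by (simp add: forall_3 sum_3 levi_civita_def kronecker_def)
  then show ?thesis by blast
qed

lemma A2_mat_tensor:
  assumes "M \<in> sym_matrices"
  shows "A2 (mat_tensor 2 (- 1) M) = mat_tensor 2 (- 1) (deviator M)"
proof -
  define N where "N = deviator M"
  have N: "N \<in> sym_traceless" using deviator_sym_traceless[OF assms] by (simp add: N_def)
  have s: "N $ j $ i = N $ i $ j" for i j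
    using N sym_matricesD[of N] by (simp add: sym_traceless_def)
  have "A2 (mat_tensor 2 (- 1) M) $ i $ j $ k $ l = mat_tensor 2 (- 1) N $ i $ j $ k $ l" for i j k l
  proof -
    \<comment> \<open>The factor -2 in \<open>Q_tensor_mat_tensor\<close> and the 1/2 in
      \<open>A2\<close> leave the sign.\<close>
    have "A2 (mat_tensor 2 (- 1) M) $ i $ j $ k $ l =
      - ((\<Sum>m\<in>UNIV. \<Sum>n\<in>UNIV. levi_civita i k m * levi_civita j l n * N $ m $ n) +
         (\<Sum>m\<in>UNIV. \<Sum>n\<in>UNIV. levi_civita i l m * levi_civita j k n * N $ m $ n))"
      by (simp add: A2_def Q_tensor_mat_tensor[OF assms] N_def sum_3 field_simps)
    also have "\<dots> = mat_tensor 2 (- 1) N $ i $ j $ k $ l"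
      unfolding levi_civita_contraction[OF N] mat_tensor_nth
      by (simp add: s kronecker_commute algebra_simps)
    finally show ?thesis .
  qed
  then show ?thesis by (simp add: vec_eq_iff N_def)
qed

lemma asym_space_eq: "asym_space = mat_tensor 2 (- 1) ` sym_matrices"
proof
  show "mat_tensor 2 (- 1) ` sym_matrices \<subseteq> asym_space"
    using mat_tensor_asym_space by blast
  show "asym_space \<subseteq> mat_tensor 2 (- 1) ` sym_matrices"
  proof
    fix A assume A: "A \<in> asym_space"
    then have el: "A \<in> elasticity" and cyc: "A $ i $ j $ k $ l + A $ i $ k $ l $ j + A $ i $ l $ j $ k = 0" for i j k l
      by (simp_all add: asym_space_iff)
    note e = elasticityD[OF el]
    \<comment> \<open>One cyclic relation for each of the 15 multisets of four indices; six of the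
      21 independent components stay free, as many as a symmetric matrix has entries.\<close>
    have c:
      "A $ 1 $ 1 $ 1 $ 1 = 0"
      "A $ 2 $ 2 $ 2 $ 2 = 0"
      "A $ 3 $ 3 $ 3 $ 3 = 0"
      "A $ 1 $ 1 $ 1 $ 2 = 0"
      "A $ 1 $ 1 $ 1 $ 3 = 0"
      "A $ 1 $ 2 $ 2 $ 2 = 0"
      "A $ 1 $ 3 $ 3 $ 3 = 0"
      "A $ 2 $ 2 $ 2 $ 3 = 0"
      "A $ 2 $ 3 $ 3 $ 3 = 0"
      "A $ 1 $ 2 $ 1 $ 2 = - A $ 1 $ 1 $ 2 $ 2 / 2"
      "A $ 1 $ 3 $ 1 $ 3 = - A $ 1 $ 1 $ 3 $ 3 / 2"
      "A $ 2 $ 3 $ 2 $ 3 = - A $ 2 $ 2 $ 3 $ 3 / 2"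
      "A $ 1 $ 2 $ 1 $ 3 = - A $ 1 $ 1 $ 2 $ 3 / 2"
      "A $ 1 $ 2 $ 2 $ 3 = - A $ 1 $ 3 $ 2 $ 2 / 2"
      "A $ 1 $ 3 $ 2 $ 3 = - A $ 1 $ 2 $ 3 $ 3 / 2"
      using cyc[of 1 1 1 1]
        cyc[of 2 2 2 2]
        cyc[of 3 3 3 3]
        cyc[of 1 1 1 2]
        cyc[of 1 1 1 3]
        cyc[of 1 2 2 2]
        cyc[of 1 3 3 3]
        cyc[of 2 2 2 3]
        cyc[of 2 3 3 3]
        cyc[of 1 1 2 2]
        cyc[of 1 1 3 3]
        cyc[of 2 2 3 3]
        cyc[of 1 1 2 3]
        cyc[of 2 2 1 3]
        cyc[of 3 3 1 2]
      by (simp_all add: e)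
    \<comment> \<open>Inverts \<open>S_trace2_mat_tensor\<close> for the weights (2, -1): there the
      double trace is twice the matrix plus twice its trace times the Kronecker symbol, and the
      scalar is 8 times the trace.\<close>
    define M where "M = (\<chi> i j. S_trace2 A i j / 2 - S_scalar A / 8 * kronecker i j)"
    have "M \<in> sym_matrices"
      using e(1) by (simp add: M_def sym_matrices_def S_trace2_def kronecker_commute)
    moreover have "\<forall>i j k l. A $ i $ j $ k $ l = mat_tensor 2 (- 1) M $ i $ j $ k $ l"
      by (simp add: forall_3 mat_tensor_nth M_def S_trace2_def S_scalar_def sum_3 kronecker_def e c field_simps)
    ultimately show "A \<in> mat_tensor 2 (- 1) ` sym_matrices"
      by (auto simp: vec_eq_iff)
  qed
qed

section \<open>Explicit description of the five piece spaces\<close>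

text \<open>Here and in the next four lemmas the formula of the piece lands in the space and fixes
  every element of it, so each \<open>T\<close> in the space is its own witness.\<close>

lemma piece_space_1: "piece_space 1 = mat_tensor 1 1 ` span {mat 1}"
proof
  show "piece_space 1 \<subseteq> mat_tensor 1 1 ` span {mat 1}"
    using S1_in by (auto simp: piece_space_def piece_def)
  show "mat_tensor 1 1 ` span {mat 1} \<subseteq> piece_space 1"
  proof
    fix T assume "T \<in> mat_tensor 1 1 ` span {mat 1}"
    then obtain c where T: "T = mat_tensor 1 1 (c *\<^sub>R mat 1)" by (auto simp: span_singleton)
    have c: "c *\<^sub>R mat 1 \<in> sym_matrices" by (simp add: subspace_scale[OF subspace_sym_matrices])
    have "T \<in> sym_space" using c by (simp add: T mat_tensor_sym_space)
    moreover have "S1 T = T"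
      by (simp add: T S1_mat_tensor[OF c] trace_scaleR trace_I)
    ultimately have "T \<in> elasticity" "T = piece 1 T"
      by (simp_all add: sym_space_iff piece_def S_part_sym_space)
    then show "T \<in> piece_space 1" unfolding piece_space_def by blast
  qed
qed

lemma piece_space_2: "piece_space 2 = mat_tensor 1 1 ` sym_traceless"
proof
  show "piece_space 2 \<subseteq> mat_tensor 1 1 ` sym_traceless"
    using S2_in[OF S_part_in_sym_space] by (auto simp: piece_space_def piece_def)
  show "mat_tensor 1 1 ` sym_traceless \<subseteq> piece_space 2"
  proof
    fix T assume "T \<in> mat_tensor 1 1 ` sym_traceless"
    then obtain M where T: "T = mat_tensor 1 1 M" and M: "M \<in> sym_traceless" by blast
    have c: "M \<in> sym_matrices" using M sym_traceless_subset by blast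
    have "T \<in> sym_space" using c by (simp add: T mat_tensor_sym_space)
    moreover have "S2 T = T"
      by (simp add: T S2_mat_tensor[OF c] deviator_id[OF M])
    ultimately have "T \<in> elasticity" "T = piece 2 T"
      by (simp_all add: sym_space_iff piece_def S_part_sym_space)
    then show "T \<in> piece_space 2" unfolding piece_space_def by blast
  qed
qed

lemma piece_space_3: "piece_space 3 = traceless_sym_space"
proof
  show "piece_space 3 \<subseteq> traceless_sym_space"
    using S3_in[OF S_part_in_sym_space] by (auto simp: piece_space_def piece_def)
  show "traceless_sym_space \<subseteq> piece_space 3"
  proof
    fix T assume T: "T \<in> traceless_sym_space"
    then have "T \<in> sym_space" by (simp add: traceless_sym_space_def)
    then have "T \<in> elasticity" "T = piece 3 T"
      by (simp_all add: sym_space_iff piece_def S_part_sym_space S3_traceless[OF T])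
    then show "T \<in> piece_space 3" unfolding piece_space_def by blast
  qed
qed

lemma piece_space_4: "piece_space 4 = mat_tensor 2 (- 1) ` span {mat 1}"
proof
  show "piece_space 4 \<subseteq> mat_tensor 2 (- 1) ` span {mat 1}"
  proof
    fix T assume "T \<in> piece_space 4"
    then obtain C where C: "C \<in> elasticity" and T: "T = A1 (A_part C)"
      by (auto simp: piece_space_def piece_def)
    obtain M where "M \<in> sym_matrices" "A_part C = mat_tensor 2 (- 1) M"
      using A_part_in_asym_space[OF C] unfolding asym_space_eq by blast
    then show "T \<in> mat_tensor 2 (- 1) ` span {mat 1}"
      unfolding T by (simp add: A1_mat_tensor imageI span_scale span_base)
  qed
  show "mat_tensor 2 (- 1) ` span {mat 1} \<subseteq> piece_space 4"
  proof
    fix T assume "T \<in> mat_tensor 2 (- 1) ` span {mat 1}"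
    then obtain c where T: "T = mat_tensor 2 (- 1) (c *\<^sub>R mat 1)" by (auto simp: span_singleton)
    have c: "c *\<^sub>R mat 1 \<in> sym_matrices" by (simp add: subspace_scale[OF subspace_sym_matrices])
    have "T \<in> asym_space" using c by (simp add: T mat_tensor_asym_space)
    moreover have "A1 T = T"
      by (simp add: T A1_mat_tensor[OF c] trace_scaleR trace_I)
    ultimately have "T \<in> elasticity" "T = piece 4 T"
      by (simp_all add: asym_space_iff piece_def A_part_asym_space)
    then show "T \<in> piece_space 4" unfolding piece_space_def by blast
  qed
qed

lemma piece_space_5: "piece_space 5 = mat_tensor 2 (- 1) ` sym_traceless"
proof
  show "piece_space 5 \<subseteq> mat_tensor 2 (- 1) ` sym_traceless"
  proof
    fix T assume "T \<in> piece_space 5"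
    then obtain C where C: "C \<in> elasticity" and T: "T = A2 (A_part C)"
      by (auto simp: piece_space_def piece_def)
    obtain M where "M \<in> sym_matrices" "A_part C = mat_tensor 2 (- 1) M"
      using A_part_in_asym_space[OF C] unfolding asym_space_eq by blast
    then show "T \<in> mat_tensor 2 (- 1) ` sym_traceless"
      unfolding T by (simp add: A2_mat_tensor imageI deviator_sym_traceless)
  qed
  show "mat_tensor 2 (- 1) ` sym_traceless \<subseteq> piece_space 5"
  proof
    fix T assume "T \<in> mat_tensor 2 (- 1) ` sym_traceless"
    then obtain M where T: "T = mat_tensor 2 (- 1) M" and M: "M \<in> sym_traceless" by blast
    have c: "M \<in> sym_matrices" using M sym_traceless_subset by blast
    have "T \<in> asym_space" using c by (simp add: T mat_tensor_asym_space)
    moreover have "A2 T = T"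
      by (simp add: T A2_mat_tensor[OF c] deviator_id[OF M])
    ultimately have "T \<in> elasticity" "T = piece 5 T"
      by (simp_all add: asym_space_iff piece_def A_part_asym_space)
    then show "T \<in> piece_space 5" unfolding piece_space_def by blast
  qed
qed

text \<open>Keeps the simplifier from turning the index 1 of a piece into \<open>Suc 0\<close>,
  where the facts about \<open>piece_space 1\<close> would no longer match.\<close>

declare One_nat_def [simp del]

subsection \<open>Orthogonality and dimensions\<close>

lemma inner_swap12: "swap12 T \<bullet> U = T \<bullet> swap12 U"
  unfolding inner_tensor4 swap12_def by (simp, rule sum.swap)

lemma inner_swap23: "swap23 T \<bullet> U = T \<bullet> swap23 U"
  unfolding inner_tensor4 swap23_def by (simp, subst (2) sum.swap, rule refl)

lemma inner_swap34: "swap34 T \<bullet> U = T \<bullet> swap34 U"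
  unfolding inner_tensor4 swap34_def by (simp, subst (3) sum.swap, rule refl)

lemma inner_outer_kronecker: "outer_kronecker M \<bullet> T = (\<Sum>i\<in>UNIV. \<Sum>j\<in>UNIV. M $ i $ j * S_trace2 T i j)"
proof -
  have "(\<Sum>l\<in>UNIV. M $ i $ j * kronecker k l * T $ i $ j $ k $ l) = M $ i $ j * T $ i $ j $ k $ k" for i j k
  proof -
    have "(\<Sum>l\<in>UNIV. M $ i $ j * kronecker k l * T $ i $ j $ k $ l) =
        (\<Sum>l\<in>UNIV. if l = k then M $ i $ j * T $ i $ j $ k $ l else 0)"
      by (intro sum.cong) (auto simp: kronecker_def)
    then show ?thesis by simp
  qed
  then show ?thesis
    by (simp add: inner_tensor4 outer_kronecker_def S_trace2_def sum_distrib_left)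
qed

text \<open>A totally symmetric \<open>T\<close> cannot distinguish the six permuted copies, two of
  weight \<open>a\<close> and four of weight \<open>b\<close>. The factor vanishes for (2, -1),
  which is the orthogonality of \<open>asym_space\<close> to \<open>sym_space\<close>.\<close>

lemma inner_mat_tensor_sym_space:
  assumes T: "T \<in> sym_space"
  shows "mat_tensor a b M \<bullet> T = (2 * a + 4 * b) * (\<Sum>i\<in>UNIV. \<Sum>j\<in>UNIV. M $ i $ j * S_trace2 T i j)"
proof -
  have "swap12 T = T" "swap23 T = T" "swap34 T = T"
    using sym_spaceD[OF T] by (simp_all add: swap12_def swap23_def swap34_def vec_eq_iff)
  then show ?thesis
    unfolding mat_tensor_outer_kronecker
    by (simp add: inner_add_left inner_swap12 inner_swap23 inner_swap34
        inner_outer_kronecker distrib_right)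
qed

lemma inner_asym_sym:
  assumes "A \<in> asym_space" "T \<in> sym_space"
  shows "A \<bullet> T = 0"
  using assms by (auto simp: asym_space_eq inner_mat_tensor_sym_space)

lemma inner_sym_asym:
  assumes "T \<in> sym_space" "A \<in> asym_space"
  shows "T \<bullet> A = 0"
  using inner_asym_sym[OF assms(2,1)] by (simp add: inner_commute)

lemma inner_traceless:
  assumes "M \<in> sym_matrices" "T \<in> traceless_sym_space"
  shows "mat_tensor 1 1 M \<bullet> T = 0"
  using assms by (simp add: traceless_sym_space_def inner_mat_tensor_sym_space)

text \<open>Contracting with the tensor of the identity matrix leaves a multiple of the trace of
  \<open>M\<close>.\<close>

lemma inner_mat_tensor_1_traceless:
  assumes M: "M \<in> sym_traceless"
  shows "mat_tensor 1 1 (c *\<^sub>R mat 1) \<bullet> mat_tensor 1 1 M = 0"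
    and "mat_tensor 2 (- 1) (c *\<^sub>R mat 1) \<bullet> mat_tensor 2 (- 1) M = 0"
proof -
  have s: "M \<in> sym_matrices" and tr: "M $ 1 $ 1 + M $ 2 $ 2 + M $ 3 $ 3 = 0"
    using M by (simp_all add: sym_traceless_def trace_def sum_3)
  have e: "mat_tensor a b (mat 1) \<bullet> mat_tensor a b M = 0" for a b
    using tr sym_matricesD[OF s, of 1 2] sym_matricesD[OF s, of 1 3] sym_matricesD[OF s, of 2 3]
    by (simp add: inner_tensor4 mat_tensor_nth sum_3 mat_1_nth kronecker_def) algebra
  then show "mat_tensor 1 1 (c *\<^sub>R mat 1) \<bullet> mat_tensor 1 1 M = 0"
    and "mat_tensor 2 (- 1) (c *\<^sub>R mat 1) \<bullet> mat_tensor 2 (- 1) M = 0"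
    by (simp_all add: linear_scale[OF linear_mat_tensor])
qed

lemma piece_space_subset_sym: "I \<in> {1, 2, 3} \<Longrightarrow> piece_space I \<subseteq> sym_space"
  by (auto simp: piece_space_1 piece_space_2 piece_space_3 traceless_sym_space_def
      mat_tensor_sym_space subsetD[OF span_mat_1_subset] subsetD[OF sym_traceless_subset])

lemma piece_space_subset_asym: "I \<in> {4, 5} \<Longrightarrow> piece_space I \<subseteq> asym_space"
  by (auto simp: piece_space_4 piece_space_5
      mat_tensor_asym_space subsetD[OF span_mat_1_subset] subsetD[OF sym_traceless_subset])

lemma atLeastAtMost_1_5: "{1..5::nat} = {1, 2, 3, 4, 5}"
  by auto

lemma subspace_piece_space: "I \<in> {1..5} \<Longrightarrow> subspace (piece_space I)"
  using linear_subspace_image[OF linear_mat_tensor subspace_span]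
    linear_subspace_image[OF linear_mat_tensor subspace_sym_traceless]
  unfolding atLeastAtMost_1_5
  by (auto simp: piece_space_1 piece_space_2 piece_space_3 piece_space_4 piece_space_5
      subspace_traceless_sym_space)

text \<open>Ordering the indices leaves ten pairs, six of which set a symmetric piece against an
  asymmetric one.\<close>

lemma piece_space_orthogonal_less:
  assumes "I \<in> {1..5}" "J \<in> {1..5}" "I < J" and x: "x \<in> piece_space I" and y: "y \<in> piece_space J"
  shows "x \<bullet> y = 0"
proof -
  consider "I = 1 \<and> J = 2" | "I = 1 \<and> J = 3" | "I = 2 \<and> J = 3" | "I = 4 \<and> J = 5"
    | "I \<in> {1, 2, 3} \<and> J \<in> {4, 5}"
    using assms(1-3) unfolding atLeastAtMost_1_5 by fastforce
  then show ?thesis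
  proof cases
    case 1
    then show ?thesis
      using x y inner_mat_tensor_1_traceless
      by (auto simp: piece_space_1 piece_space_2 span_singleton)
  next
    case 2
    then show ?thesis
      using x y span_mat_1_subset inner_traceless by (auto simp: piece_space_1 piece_space_3)
  next
    case 3
    then show ?thesis
      using x y sym_traceless_subset inner_traceless by (auto simp: piece_space_2 piece_space_3)
  next
    case 4
    then show ?thesis
      using x y inner_mat_tensor_1_traceless
      by (auto simp: piece_space_4 piece_space_5 span_singleton)
  next
    case 5
    then have "x \<in> sym_space" "y \<in> asym_space"
      using x y piece_space_subset_sym[of I] piece_space_subset_asym[of J] by blast+
    then show ?thesis
      by (rule inner_sym_asym)
  qed
qed

lemma piece_space_orthogonal:
  assumes "I \<in> {1..5}" "J \<in> {1..5}" "I \<noteq> J" "x \<in> piece_space I" "y \<in> piece_space J"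
  shows "x \<bullet> y = 0"
  using assms piece_space_orthogonal_less[of I J x y] piece_space_orthogonal_less[of J I y x]
  by (cases "I < J") (auto simp: inner_commute)

lemma piece_in: "C \<in> elasticity \<Longrightarrow> piece I C \<in> piece_space I"
  by (auto simp: piece_space_def)

lemma A1_A2_sum:
  assumes "A \<in> asym_space"
  shows "A1 A + A2 A = A"
proof -
  obtain M where "M \<in> sym_matrices" "A = mat_tensor 2 (- 1) M"
    using assms unfolding asym_space_eq by blast
  then show ?thesis
    by (simp add: A1_mat_tensor A2_mat_tensor flip: mat_tensor_split)
qed

lemma S_part_eq_pieces: "S_part C = piece 1 C + piece 2 C + piece 3 C"
  by (simp add: piece_def S3_def)

lemma A_part_eq_pieces: "C \<in> elasticity \<Longrightarrow> A_part C = piece 4 C + piece 5 C"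
  by (simp add: piece_def A1_A2_sum A_part_in_asym_space)

lemma sum_pieces:
  assumes "C \<in> elasticity"
  shows "C = (\<Sum>I=1..5. piece I C)"
proof -
  have "C = S_part C + A_part C" by (simp add: A_part_def)
  then show ?thesis
    unfolding atLeastAtMost_1_5
    by (simp add: S_part_eq_pieces A_part_eq_pieces[OF assms] add.assoc)
qed

section \<open>Direct sum decompositions\<close>

lemma internal_direct_sum_SA:
  "internal_direct_sum {1, 2} (\<lambda>m::nat. if m = 1 then sym_space else asym_space) elasticity"
proof (rule internal_direct_sum_orthogonal)
  show "\<exists>w. (\<forall>i\<in>{1, 2}. w i \<in> (if i = (1::nat) then sym_space else asym_space)) \<and> v = (\<Sum>i\<in>{1, 2}. w i)"
    if "v \<in> elasticity" for v
    using S_part_in_sym_space[OF that] A_part_in_asym_space[OF that]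
    by (intro exI[of _ "\<lambda>i. if i = 1 then S_part v else A_part v"]) (simp add: A_part_def)
  show "x \<bullet> y = 0" if "i \<in> {1, 2}" "j \<in> {1, 2}" "i \<noteq> j" "x \<in> (if i = 1 then sym_space else asym_space)"
    "y \<in> (if j = 1 then sym_space else asym_space)" for i j :: nat and x y
    using that inner_asym_sym[of x y] inner_asym_sym[of y x] by (auto simp: inner_commute split: if_splits)
qed (auto simp: subspace_elasticity subspace_sym_space subspace_asym_space sym_space_iff asym_space_iff)

text \<open>Directness comes from orthogonality, so for each of the three sums only the expansion of
  an element into its own pieces is left to supply.\<close>

lemma internal_direct_sum_pieces:
  assumes I: "I \<subseteq> {1..5}" and V: "subspace V" "V \<subseteq> elasticity"
    and W: "\<And>i. i \<in> I \<Longrightarrow> piece_space i \<subseteq> V" and ex: "\<And>v. v \<in> V \<Longrightarrow> v = (\<Sum>i\<in>I. piece i v)"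
  shows "internal_direct_sum I piece_space V"
proof (rule internal_direct_sum_orthogonal)
  show "finite I" using I finite_subset by blast
  show "subspace V" by fact
  show "subspace (piece_space i) \<and> piece_space i \<subseteq> V" if "i \<in> I" for i
    using subspace_piece_space W I that by blast
  show "x \<bullet> y = 0" if "i \<in> I" "j \<in> I" "i \<noteq> j" "x \<in> piece_space i" "y \<in> piece_space j" for i j x y
    using that I piece_space_orthogonal[of i j x y] by blast
  show "\<exists>w. (\<forall>i\<in>I. w i \<in> piece_space i) \<and> v = (\<Sum>i\<in>I. w i)" if "v \<in> V" for v
    using ex[OF that] piece_in that V by (intro exI[of _ "\<lambda>i. piece i v"]) auto
qed

lemma piece_space_subset: "I \<in> {1..5} \<Longrightarrow> piece_space I \<subseteq> elasticity"
  using piece_space_subset_sym[of I] piece_space_subset_asym[of I]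
  unfolding atLeastAtMost_1_5 sym_space_def asym_space_def by blast

lemma internal_direct_sum_elasticity: "internal_direct_sum {1..5} piece_space elasticity"
  by (intro internal_direct_sum_pieces subspace_elasticity sum_pieces piece_space_subset) auto

lemma internal_direct_sum_sym: "internal_direct_sum {1, 2, 3} piece_space sym_space"
proof (rule internal_direct_sum_pieces)
  show "v = (\<Sum>i\<in>{1, 2, 3}. piece i v)" if "v \<in> sym_space" for v
    using S_part_sym_space[OF that] S_part_eq_pieces[of v] by (simp add: add.assoc)
qed (use subspace_sym_space piece_space_subset_sym in \<open>auto simp: sym_space_iff\<close>)

lemma internal_direct_sum_asym: "internal_direct_sum {4, 5} piece_space asym_space"
proof (rule internal_direct_sum_pieces)
  show "v = (\<Sum>i\<in>{4, 5}. piece i v)" if "v \<in> asym_space" for v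
    using A_part_asym_space[OF that] A_part_eq_pieces[of v] that by (simp add: asym_space_iff)
qed (use subspace_asym_space piece_space_subset_asym in \<open>auto simp: asym_space_iff\<close>)

section \<open>Dimensions\<close>

text \<open>The defining symmetries say exactly that a component depends only on the unordered pair
  of the unordered pairs \<open>{i, j}\<close> and \<open>{k, l}\<close>; the dimension is the
  number of such pairs, 6 + 15.\<close>

lemma dim_elasticity: "dim elasticity = 21"
proof -
  define e :: "3 \<times> 3 \<times> 3 \<times> 3 \<Rightarrow> tensor4"
    where "e = (\<lambda>(i, j, k, l). axis i (axis j (axis k (axis l 1))))"
  define \<kappa> :: "3 \<times> 3 \<times> 3 \<times> 3 \<Rightarrow> 3 set set" where "\<kappa> = (\<lambda>(i, j, k, l). {{i, j}, {k, l}})"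
  have "inj e"
    by (auto simp: inj_def e_def axis_eq_axis)
  moreover have "range e = Basis"
  proof
    show "range e \<subseteq> Basis"
      by (auto simp: e_def axis_in_Basis_iff)
    show "Basis \<subseteq> range e"
    proof
      fix b :: tensor4 assume "b \<in> Basis"
      then obtain i j k l where "b = axis i (axis j (axis k (axis l 1)))"
        by (auto simp: Basis_vec_def)
      then have "b = e (i, j, k, l)" by (simp add: e_def)
      then show "b \<in> range e" by blast
    qed
  qed
  ultimately have "bij_betw e UNIV Basis" by (simp add: bij_betw_def)
  then have "dim {x. \<forall>p q. \<kappa> p = \<kappa> q \<longrightarrow> x \<bullet> e p = x \<bullet> e q} = card (range \<kappa>)"
    by (rule dim_constant_on_fibres)
  moreover have "{x. \<forall>p q. \<kappa> p = \<kappa> q \<longrightarrow> x \<bullet> e p = x \<bullet> e q} = elasticity"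
  proof -
    have "x \<in> elasticity \<longleftrightarrow> (\<forall>i j k l i' j' k' l'. {{i, j}, {k, l}} = {{i', j'}, {k', l'}} \<longrightarrow>
        x $ i $ j $ k $ l = x $ i' $ j' $ k' $ l')" (is "_ \<longleftrightarrow> ?R") for x
    proof
      assume "x \<in> elasticity"
      note x = elasticityD[OF this]
      have *: "x $ i $ j $ k $ l = x $ i' $ j' $ k' $ l'" if "{i, j} = {i', j'}" "{k, l} = {k', l'}"
        for i j k l i' j' k' l'
        using that x(1)[of i j k l] x(2)[of i j k l] x(1)[of i j l k] by (auto simp: doubleton_eq_iff)
      show ?R
      proof (intro allI impI)
        fix i j k l i' j' k' l' :: 3
        assume "{{i, j}, {k, l}} = {{i', j'}, {k', l'}}"
        then consider "{i, j} = {i', j'}" "{k, l} = {k', l'}" | "{i, j} = {k', l'}" "{k, l} = {i', j'}"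
          unfolding doubleton_eq_iff[of "{i, j}"] by blast
        then show "x $ i $ j $ k $ l = x $ i' $ j' $ k' $ l'"
          by cases (use *[of i j i' j' k l k' l'] *[of i j k' l' k l i' j'] x(3)[of k' l' i' j'] in simp_all)
      qed
    next
      assume R: ?R
      have "x $ i $ j $ k $ l = x $ j $ i $ k $ l \<and> x $ i $ j $ k $ l = x $ k $ l $ i $ j" for i j k l
        by (intro conjI R[rule_format]) (simp_all add: insert_commute)
      then show "x \<in> elasticity" by (simp add: elasticity_def)
    qed
    then show ?thesis by (simp add: set_eq_iff e_def \<kappa>_def inner_axis)
  qed
  moreover have "card (range \<kappa>) = 21"
  proof -
    define D :: "3 set set" where "D = {{a, b} | a b. a \<in> UNIV \<and> b \<in> UNIV}"
    have "card D = 6"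
      unfolding D_def by (subst card_doubletons) (simp_all add: choose_two)
    moreover have "range \<kappa> = {{a, b} | a b. a \<in> D \<and> b \<in> D}"
    proof (intro equalityI subsetI)
      fix x assume "x \<in> range \<kappa>"
      then obtain i j k l where "x = {{i, j}, {k, l}}" by (auto simp: \<kappa>_def)
      moreover have "{a, b} \<in> D" for a b unfolding D_def by blast
      ultimately show "x \<in> {{a, b} | a b. a \<in> D \<and> b \<in> D}"
        by (intro CollectI exI conjI) assumption+
    next
      fix x assume "x \<in> {{a, b} | a b. a \<in> D \<and> b \<in> D}"
      then obtain a b where "x = {a, b}" "a \<in> D" "b \<in> D" by blast
      moreover from this obtain i j k l where "a = {i, j}" "b = {k, l}" unfolding D_def by blast
      ultimately have "x = \<kappa> (i, j, k, l)" by (simp add: \<kappa>_def)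
      then show "x \<in> range \<kappa>" by blast
    qed
    ultimately show ?thesis
      using card_doubletons[of D] by (simp add: choose_two)
  qed
  ultimately show ?thesis by simp
qed

text \<open>Traces recover \<open>M\<close>: first its trace, with factor
  \<open>6 * a + 4 * b\<close>, then each entry, with factor \<open>3 * a + 4 * b\<close>. The
  factors are 10 and 7 for weights (1, 1), and 8 and 2 for (2, -1).\<close>

lemma inj_on_mat_tensor:
  assumes "3 * a + 4 * b \<noteq> 0" "6 * a + 4 * b \<noteq> 0"
  shows "inj_on (mat_tensor a b) sym_matrices"
proof (rule inj_onI)
  fix M N assume M: "M \<in> sym_matrices" and N: "N \<in> sym_matrices" and eq: "mat_tensor a b M = mat_tensor a b N"
  have "trace M = trace N"
    using S_scalar_mat_tensor[OF M, of a b] S_scalar_mat_tensor[OF N, of a b] eq assms(2) by simp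
  then have "(3 * a + 4 * b) * M $ i $ j = (3 * a + 4 * b) * N $ i $ j" for i j
    using S_trace2_mat_tensor[OF M, of a b i j] S_trace2_mat_tensor[OF N, of a b i j] eq by (metis add_right_cancel)
  then show "M = N" using assms(1) by (simp add: vec_eq_iff)
qed

lemma dim_image_mat_tensor:
  assumes "subspace W" "W \<subseteq> sym_matrices" "3 * a + 4 * b \<noteq> 0" "6 * a + 4 * b \<noteq> 0"
  shows "dim (mat_tensor a b ` W) = dim W"
proof (rule dim_image_eq[OF linear_mat_tensor])
  show "inj_on (mat_tensor a b) (span W)"
    using inj_on_subset[OF inj_on_mat_tensor[OF assms(3,4)]] assms(1,2) by (simp add: span_eq_iff[THEN iffD2])
qed

lemma dim_sym_traceless: "dim sym_traceless = 5"
proof -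
  define f :: "real \<times> real \<times> real \<times> real \<times> real \<Rightarrow> real^3^3"
    where "f = (\<lambda>(a, b, c, d, e). vector [vector [a, b, c], vector [b, d, e], vector [c, e, - a - d]])"
  have lin: "linear f"
    by (rule linearI) (auto simp: f_def vec_eq_iff forall_3 algebra_simps)
  have "inj f"
    by (auto simp: inj_def f_def vec_eq_iff forall_3)
  have "range f = sym_traceless"
  proof
    show "range f \<subseteq> sym_traceless"
      by (auto simp: f_def sym_traceless_def sym_matrices_def forall_3 trace_def sum_3)
    show "sym_traceless \<subseteq> range f"
    proof
      fix M assume M: "M \<in> sym_traceless"
      then have s: "M \<in> sym_matrices" and "trace M = 0" by (simp_all add: sym_traceless_def)
      then have tr: "M $ 3 $ 3 = - M $ 1 $ 1 - M $ 2 $ 2" by (simp add: trace_def sum_3)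
      have "M = f (M $ 1 $ 1, M $ 1 $ 2, M $ 1 $ 3, M $ 2 $ 2, M $ 2 $ 3)"
        using sym_matricesD[OF s, of 1 2] sym_matricesD[OF s, of 1 3] sym_matricesD[OF s, of 2 3] tr
        by (simp add: f_def vec_eq_iff forall_3)
      then show "M \<in> range f" by blast
    qed
  qed
  moreover have "dim (range f) = dim (UNIV :: (real \<times> real \<times> real \<times> real \<times> real) set)"
    using \<open>inj f\<close> by (intro dim_image_eq[OF lin]) simp
  ultimately show ?thesis by simp
qed

lemma dim_span_mat_1: "dim (span {mat 1 :: real^3^3}) = 1"
proof -
  have "(mat 1 :: real^3^3) $ 1 $ 1 \<noteq> 0" by (simp add: mat_def)
  then have "(mat 1 :: real^3^3) \<noteq> 0" by (metis zero_index)
  then show ?thesis by simp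
qed

lemma dim_piece_space_1: "dim (piece_space 1) = 1"
  and dim_piece_space_2: "dim (piece_space 2) = 5"
  and dim_piece_space_4: "dim (piece_space 4) = 1"
  and dim_piece_space_5: "dim (piece_space 5) = 5"
  unfolding piece_space_1 piece_space_2 piece_space_4 piece_space_5
  by (subst dim_image_mat_tensor; simp add: span_mat_1_subset sym_traceless_subset dim_sym_traceless
      dim_span_mat_1 subspace_sym_traceless del: dim_span)+

lemma dim_asym_space: "dim asym_space = 6"
proof -
  have "dim asym_space = (\<Sum>i\<in>{4, 5}. dim (piece_space i))"
    by (rule dim_internal_direct_sum_orthogonal[OF internal_direct_sum_asym])
      (rule piece_space_orthogonal, auto)
  then show ?thesis
    by (simp add: dim_piece_space_4 dim_piece_space_5)
qed

text \<open>By subtraction, 21 - 6; in the same way piece 3 then gets 15 - 1 - 5, with no basis of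
  traceless tensors written down.\<close>

lemma dim_sym_space: "dim sym_space = 15"
proof -
  have "dim elasticity = (\<Sum>i\<in>{1, 2::nat}. dim (if i = 1 then sym_space else asym_space))"
    by (intro dim_internal_direct_sum_orthogonal[OF internal_direct_sum_SA])
      (auto simp: inner_asym_sym inner_sym_asym split: if_splits)
  then show ?thesis by (simp add: dim_elasticity dim_asym_space)
qed

lemma dim_piece_space_3: "dim (piece_space 3) = 9"
proof -
  have "dim sym_space = (\<Sum>i\<in>{1, 2, 3}. dim (piece_space i))"
    by (rule dim_internal_direct_sum_orthogonal[OF internal_direct_sum_sym])
      (rule piece_space_orthogonal, auto)
  then show ?thesis
    by (simp add: dim_sym_space dim_piece_space_1 dim_piece_space_2)
qed

subsection \<open>Irreducibility\<close>

text \<open>The rotations by \<open>\<pi>/2\<close> and by \<open>arctan (4/3)\<close> about the third axis. They have rational entries,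
  and a totally symmetric tensor fixed by both is fixed by all rotations about this axis.\<close>

definition quarter_turn :: "real^3^3" where
  "quarter_turn = vector [vector [0, - 1, 0], vector [1, 0, 0], vector [0, 0, 1]]"

definition pythagorean_turn :: "real^3^3" where
  "pythagorean_turn = vector [vector [3 / 5, - 4 / 5, 0], vector [4 / 5, 3 / 5, 0], vector [0, 0, 1]]"

lemma quarter_turn_SO3: "quarter_turn \<in> SO3"
  by (simp add: SO3_def rotation_matrix_def orthogonal_matrix quarter_turn_def det_3
      vec_eq_iff forall_3 matrix_matrix_mult_def transpose_def sum_3 mat_def)

lemma pythagorean_turn_SO3: "pythagorean_turn \<in> SO3"
  by (simp add: SO3_def rotation_matrix_def orthogonal_matrix pythagorean_turn_def det_3
      vec_eq_iff forall_3 matrix_matrix_mult_def transpose_def sum_3 mat_def)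

lemma turn_column_3: "quarter_turn $ i $ 3 = kronecker i 3" "pythagorean_turn $ i $ 3 = kronecker i 3"
  using exhaust_3[of i] by (auto simp: quarter_turn_def pythagorean_turn_def kronecker_def)

definition axis4 :: tensor4 where
  "axis4 = axis 3 (axis 3 (axis 3 (axis 3 1)))"

lemma inner_axis4: "T \<bullet> axis4 = T $ 3 $ 3 $ 3 $ 3"
  by (simp add: axis4_def inner_axis)

lemma axis4_nth: "axis4 $ i $ j $ k $ l = kronecker i 3 * kronecker j 3 * kronecker k 3 * kronecker l 3"
  by (simp add: axis4_def axis_def kronecker_def)

lemma act_axis4_nth: "act g axis4 $ i $ j $ k $ l = g $ i $ 3 * g $ j $ 3 * g $ k $ 3 * g $ l $ 3"
  by (simp add: act_nth axis4_nth sum_3 kronecker_def)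

lemma act_axis4:
  assumes "\<And>i. g $ i $ 3 = kronecker i 3"
  shows "act g axis4 = axis4"
  by (simp add: vec_eq_iff act_axis4_nth axis4_nth assms)

definition zonal :: "tensor4 \<Rightarrow> bool" where
  "zonal T \<longleftrightarrow> act quarter_turn T = T \<and> act pythagorean_turn T = T"

text \<open>Only 1122, 1133 and 3333 remain free. Components with an index 3 are forms of degree at
  most three in the plane, and there the quarter turn fixes nothing but the rotation-invariant part.
  Plane forms of degree four also contain the angular frequency 4, which the quarter turn fixes and
  the other rotation excludes.\<close>

lemma zonal_components:
  assumes T: "T \<in> sym_space" and z: "zonal T"
  shows "T $ 1 $ 1 $ 1 $ 1 = 3 * T $ 1 $ 1 $ 2 $ 2" "T $ 2 $ 2 $ 2 $ 2 = 3 * T $ 1 $ 1 $ 2 $ 2"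
    "T $ 1 $ 1 $ 1 $ 2 = 0" "T $ 1 $ 2 $ 2 $ 2 = 0" "T $ 1 $ 1 $ 1 $ 3 = 0" "T $ 1 $ 1 $ 2 $ 3 = 0"
    "T $ 1 $ 2 $ 2 $ 3 = 0" "T $ 2 $ 2 $ 2 $ 3 = 0" "T $ 1 $ 2 $ 3 $ 3 = 0"
    "T $ 2 $ 2 $ 3 $ 3 = T $ 1 $ 1 $ 3 $ 3" "T $ 1 $ 3 $ 3 $ 3 = 0" "T $ 2 $ 3 $ 3 $ 3 = 0"
proof -
  note s = sym_spaceD[OF T]
  have q: "act quarter_turn T $ i $ j $ k $ l = T $ i $ j $ k $ l"
    and p: "act pythagorean_turn T $ i $ j $ k $ l = T $ i $ j $ k $ l" for i j k l
    using z by (simp_all add: zonal_def)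
  have 1: "T $ 2 $ 2 $ 2 $ 2 = T $ 1 $ 1 $ 1 $ 1" "T $ 1 $ 2 $ 2 $ 2 = - T $ 1 $ 1 $ 1 $ 2"
    using q[of 1 1 1 1] q[of 1 1 1 2]
    by (simp_all add: act_nth sum_3 quarter_turn_def s)
  have "T $ 1 $ 1 $ 1 $ 1 = 3 * T $ 1 $ 1 $ 2 $ 2 \<and> T $ 1 $ 1 $ 1 $ 2 = 0"
    using p[of 1 1 1 1] p[of 1 1 1 2] 1
    by (simp add: act_nth sum_3 pythagorean_turn_def s)
  then show "T $ 1 $ 1 $ 1 $ 1 = 3 * T $ 1 $ 1 $ 2 $ 2" "T $ 2 $ 2 $ 2 $ 2 = 3 * T $ 1 $ 1 $ 2 $ 2"
    "T $ 1 $ 1 $ 1 $ 2 = 0" "T $ 1 $ 2 $ 2 $ 2 = 0"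
    using 1 by simp_all
  show "T $ 1 $ 1 $ 1 $ 3 = 0" "T $ 2 $ 2 $ 2 $ 3 = 0"
    using q[of 1 1 1 3] q[of 2 2 2 3] by (simp_all add: act_nth sum_3 quarter_turn_def s)
  show "T $ 1 $ 1 $ 2 $ 3 = 0" "T $ 1 $ 2 $ 2 $ 3 = 0"
    using q[of 1 1 2 3] q[of 1 2 2 3] by (simp_all add: act_nth sum_3 quarter_turn_def s)
  show "T $ 1 $ 2 $ 3 $ 3 = 0" "T $ 2 $ 2 $ 3 $ 3 = T $ 1 $ 1 $ 3 $ 3"
    using q[of 1 2 3 3] q[of 1 1 3 3] by (simp_all add: act_nth sum_3 quarter_turn_def s)
  show "T $ 1 $ 3 $ 3 $ 3 = 0" "T $ 2 $ 3 $ 3 $ 3 = 0"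
    using q[of 1 3 3 3] q[of 2 3 3 3] by (simp_all add: act_nth sum_3 quarter_turn_def s)
qed

text \<open>By total symmetry a component depends only on the multiset of its four indices, and
  there are 15 of these.\<close>

lemma sym_space_eq_0I:
  assumes T: "T \<in> sym_space"
    and "T $ 1 $ 1 $ 1 $ 1 = 0" "T $ 2 $ 2 $ 2 $ 2 = 0" "T $ 3 $ 3 $ 3 $ 3 = 0"
    "T $ 1 $ 1 $ 1 $ 2 = 0" "T $ 1 $ 1 $ 1 $ 3 = 0" "T $ 1 $ 2 $ 2 $ 2 = 0" "T $ 1 $ 3 $ 3 $ 3 = 0"
    "T $ 2 $ 2 $ 2 $ 3 = 0" "T $ 2 $ 3 $ 3 $ 3 = 0" "T $ 1 $ 1 $ 2 $ 2 = 0" "T $ 1 $ 1 $ 3 $ 3 = 0"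
    "T $ 2 $ 2 $ 3 $ 3 = 0" "T $ 1 $ 1 $ 2 $ 3 = 0" "T $ 1 $ 2 $ 2 $ 3 = 0" "T $ 1 $ 2 $ 3 $ 3 = 0"
  shows "T = 0"
  by (simp add: vec_eq_iff forall_3 sym_spaceD[OF T] assms(2-))

text \<open>Polarization: the quartic form of \<open>T\<close> vanishes on the unit sphere, hence everywhere.\<close>

lemma sym_space_eq_0_rotations:
  assumes T: "T \<in> sym_space" and 0: "\<And>k. k \<in> SO3 \<Longrightarrow> act k T $ 3 $ 3 $ 3 $ 3 = 0"
  shows "T = 0"
proof -
  note s = sym_spaceD[OF T]
  define f where "f x = (\<Sum>a\<in>UNIV. \<Sum>b\<in>UNIV. \<Sum>c\<in>UNIV. \<Sum>d\<in>UNIV. x $ a * x $ b * x $ c * x $ d * T $ a $ b $ c $ d)"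
    for x :: "real^3"
  have f: "f x = 0" for x
  proof (cases "x = 0")
    case True
    then show ?thesis by (simp add: f_def)
  next
    case False
    define u where "u = x /\<^sub>R norm x"
    have "norm u = 1" using False by (simp add: u_def)
    then obtain A where A: "rotation_matrix A" "A *v axis 3 1 = u"
      using rotation_matrix_exists_basis[of u 3] by auto
    \<comment> \<open>The component 3333 of \<open>act k T\<close> is the quartic form at the third
      row of \<open>k\<close>, so a rotation whose third row is \<open>u\<close> is wanted.\<close>
    have "transpose A \<in> SO3" using A by (intro SO3_transpose) (simp add: SO3_def)
    moreover have "transpose A $ 3 = u"
      using A(2) by (simp add: matrix_vector_mult_basis column_def transpose_def vec_eq_iff)
    ultimately have "f u = 0" using 0[of "transpose A"] by (simp add: act_nth f_def)
    moreover have "f (r *\<^sub>R u) = r ^ 4 * f u" for r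
      by (simp add: f_def sum_distrib_left power4_eq_xxxx mult_ac)
    moreover have "x = norm x *\<^sub>R u" using False by (simp add: u_def)
    ultimately show ?thesis by (metis mult_zero_right)
  qed
  \<comment> \<open>The coefficients 1, 4, 6, 12 are the multinomial ones.\<close>
  have g: "f (vector [p, q, r]) = 
      p^4 * T $ 1 $ 1 $ 1 $ 1 + q^4 * T $ 2 $ 2 $ 2 $ 2 + r^4 * T $ 3 $ 3 $ 3 $ 3 +
      4 * p^3 * q * T $ 1 $ 1 $ 1 $ 2 + 4 * p^3 * r * T $ 1 $ 1 $ 1 $ 3 +
      4 * p * q^3 * T $ 1 $ 2 $ 2 $ 2 + 4 * p * r^3 * T $ 1 $ 3 $ 3 $ 3 +
      4 * q^3 * r * T $ 2 $ 2 $ 2 $ 3 + 4 * q * r^3 * T $ 2 $ 3 $ 3 $ 3 +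
      6 * p^2 * q^2 * T $ 1 $ 1 $ 2 $ 2 + 6 * p^2 * r^2 * T $ 1 $ 1 $ 3 $ 3 + 6 * q^2 * r^2 * T $ 2 $ 2 $ 3 $ 3 +
      12 * p^2 * q * r * T $ 1 $ 1 $ 2 $ 3 + 12 * p * q^2 * r * T $ 1 $ 2 $ 2 $ 3 +
      12 * p * q * r^2 * T $ 1 $ 2 $ 3 $ 3" for p q r
    by (simp add: f_def sum_3 s power2_eq_square power3_eq_cube power4_eq_xxxx algebra_simps)
  note h = g[unfolded f]
  have 1: "T $ 1 $ 1 $ 1 $ 1 = 0" "T $ 2 $ 2 $ 2 $ 2 = 0" "T $ 3 $ 3 $ 3 $ 3 = 0"
    using h[of 1 0 0] h[of 0 1 0] h[of 0 0 1] by simp_all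
  \<comment> \<open>On each coordinate plane three coefficients are left, and the values at (1, 1),
    (1, -1) and (1, 2) determine them.\<close>
  have 2: "T $ 1 $ 1 $ 1 $ 2 = 0 \<and> T $ 1 $ 2 $ 2 $ 2 = 0 \<and> T $ 1 $ 1 $ 2 $ 2 = 0"
    using h[of 1 1 0] h[of 1 "-1" 0] h[of 1 2 0] by (simp add: 1)
  have 3: "T $ 1 $ 1 $ 1 $ 3 = 0 \<and> T $ 1 $ 3 $ 3 $ 3 = 0 \<and> T $ 1 $ 1 $ 3 $ 3 = 0"
    using h[of 1 0 1] h[of 1 0 "-1"] h[of 1 0 2] by (simp add: 1)
  have 4: "T $ 2 $ 2 $ 2 $ 3 = 0 \<and> T $ 2 $ 3 $ 3 $ 3 = 0 \<and> T $ 2 $ 2 $ 3 $ 3 = 0"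
    using h[of 0 1 1] h[of 0 1 "-1"] h[of 0 1 2] by (simp add: 1)
  \<comment> \<open>The last three terms are told apart by the signs of the coordinates.\<close>
  have 5: "T $ 1 $ 1 $ 2 $ 3 = 0 \<and> T $ 1 $ 2 $ 2 $ 3 = 0 \<and> T $ 1 $ 2 $ 3 $ 3 = 0"
    using h[of 1 1 1] h[of "-1" 1 1] h[of 1 "-1" 1] by (simp add: 1 2 3 4)
  show ?thesis
    using 1 2 3 4 5 by (intro sym_space_eq_0I[OF T]) simp_all
qed

lemma SO3_invariantD: "SO3_invariant W \<Longrightarrow> g \<in> SO3 \<Longrightarrow> T \<in> W \<Longrightarrow> act g T \<in> W"
  by (simp add: SO3_invariant_def)

lemma SO3_invariant_orthogonal:
  assumes "SO3_invariant U"
  shows "SO3_invariant {v. \<forall>u\<in>U. v \<bullet> u = 0}"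
  using assms SO3_transpose by (auto simp: SO3_invariant_def act_adjoint)

lemma SO3_invariant_Int: "SO3_invariant U \<Longrightarrow> SO3_invariant V \<Longrightarrow> SO3_invariant (U \<inter> V)"
  by (simp add: SO3_invariant_def)

lemma subspace_orthogonal: "subspace {v::'a::real_inner. \<forall>u\<in>U. v \<bullet> u = 0}"
  by (simp add: subspace_def inner_add_left)

text \<open>The witness is the projection of \<^term>\<open>axis4\<close> to \<open>X\<close>.\<close>

lemma zonal_in_invariant_subspace:
  assumes X: "subspace X" "SO3_invariant X" "X \<subseteq> sym_space" "X \<noteq> {0}"
  obtains y where "y \<in> X" "zonal y" "y \<noteq> 0"
proof -
  obtain T where T: "T \<in> X" "T \<noteq> 0"
    using X(1,4) subspace_0 by blast
  then obtain k where k: "k \<in> SO3" "act k T $ 3 $ 3 $ 3 $ 3 \<noteq> 0"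
    using sym_space_eq_0_rotations X(3) by blast
  obtain y z where y: "y \<in> span X" and z: "\<And>w. w \<in> span X \<Longrightarrow> orthogonal z w" and e: "axis4 = y + z"
    using orthogonal_subspace_decomp_exists by metis
  have sp: "span X = X" using X(1) by (simp add: span_eq_iff)
  have y: "y \<in> X" using y sp by simp
  have z: "z \<bullet> w = 0" if "w \<in> X" for w
    using z sp that by (simp add: orthogonal_def)
  \<comment> \<open>Uniqueness of the orthogonal decomposition: \<open>act g y\<close> lies in
    \<open>X\<close>, \<open>act g z\<close> is orthogonal to \<open>X\<close>, and their sum is
    again \<open>axis4\<close>.\<close>
  have fixed: "act g y = y" if g: "g \<in> SO3" "act g axis4 = axis4" for g
  proof -
    have gy: "y - act g y \<in> X"
      using y X g by (intro subspace_diff SO3_invariantD)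
    have "act g y + act g z = y + z"
      using g(2) unfolding e by (simp add: act_add)
    then have "y - act g y = act g z - z" by (simp add: algebra_simps)
    moreover have "act g z \<bullet> w = 0" if "w \<in> X" for w
      unfolding act_adjoint using z SO3_invariantD[OF X(2) SO3_transpose[OF g(1)] that] by simp
    ultimately have "(y - act g y) \<bullet> (y - act g y) = 0"
      using z[OF gy] gy by (subst (1) \<open>y - act g y = act g z - z\<close>) (simp add: inner_diff_left)
    then show ?thesis by simp
  qed
  have "zonal y"
    unfolding zonal_def
    by (intro conjI fixed quarter_turn_SO3 pythagorean_turn_SO3 act_axis4 turn_column_3)
  \<comment> \<open>The left side is the nonzero component 3333 of \<open>act k T\<close>, an
    element of \<open>X\<close>, so \<open>z\<close> contributes nothing and \<open>y\<close> cannot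
    vanish.\<close>
  moreover have "act k T \<bullet> axis4 = act k T \<bullet> y"
    using z[OF SO3_invariantD[OF X(2) k(1) T(1)]] by (simp add: e inner_add_right inner_commute)
  then have "y \<noteq> 0" using k(2) by (auto simp: inner_axis4)
  ultimately show ?thesis using y that by blast
qed

text \<open>The last hypothesis says that the zonal tensors of \<open>W\<close> are at most a line,
  with the component 3333 as coordinate.\<close>

lemma SO3_irreducibleI_zonal:
  assumes W: "subspace W" "SO3_invariant W" "W \<subseteq> sym_space" "W \<noteq> {0}"
    and zon: "\<And>T. T \<in> W \<Longrightarrow> zonal T \<Longrightarrow> T $ 3 $ 3 $ 3 $ 3 = 0 \<Longrightarrow> T = 0"
  shows "SO3_irreducible W"
  unfolding SO3_irreducible_def
proof (intro conjI W(1,2,4) allI impI)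
  fix U assume U: "subspace U \<and> U \<subseteq> W \<and> SO3_invariant U"
  define V where "V = W \<inter> {v. \<forall>u\<in>U. v \<bullet> u = 0}"
  have V: "subspace V" "SO3_invariant V" "V \<subseteq> W"
    using W U subspace_orthogonal[of U]
    by (auto simp: V_def subspace_inter intro: SO3_invariant_Int SO3_invariant_orthogonal)
  show "U = {0} \<or> U = W"
  proof (rule ccontr)
    assume "\<not> (U = {0} \<or> U = W)"
    then have "U \<noteq> {0}" "U \<noteq> W" by auto
    have "V \<noteq> {0}"
    proof
      assume "V = {0}"
      have "W \<subseteq> U"
      proof
        fix w assume w: "w \<in> W"
        obtain y z where y: "y \<in> span U" and z: "\<And>x. x \<in> span U \<Longrightarrow> orthogonal z x" and e: "w = y + z"
          using orthogonal_subspace_decomp_exists by metis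
        have sp: "span U = U" using U by (simp add: span_eq_iff)
        have "z \<in> W" using w y sp e U W(1) subspace_diff[of W w y] by auto
        then have "z \<in> V" using z sp by (simp add: V_def orthogonal_def)
        then show "w \<in> U" using \<open>V = {0}\<close> e y sp by simp
      qed
      then show False using U \<open>U \<noteq> W\<close> by blast
    qed
    obtain u where u: "u \<in> U" "zonal u" "u \<noteq> 0"
      using zonal_in_invariant_subspace[of U] U W(3) \<open>U \<noteq> {0}\<close> by blast
    obtain v where v: "v \<in> V" "zonal v" "v \<noteq> 0"
      using zonal_in_invariant_subspace[of V] V W(3) \<open>V \<noteq> {0}\<close> by blast
    define a b where "a = u $ 3 $ 3 $ 3 $ 3" and "b = v $ 3 $ 3 $ 3 $ 3"
    have uW: "u \<in> W" and vW: "v \<in> W" using u v U V by auto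
    have "b \<noteq> 0" using zon[OF vW v(2)] v(3) by (auto simp: b_def)
    \<comment> \<open>The combination whose component 3333 cancels; its product with
      \<open>u\<close> is \<open>b * (u \<bullet> u)\<close>, since \<open>v\<close> is orthogonal
      to \<open>u\<close>.\<close>
    have "b *\<^sub>R u - a *\<^sub>R v = 0"
    proof (rule zon)
      show "b *\<^sub>R u - a *\<^sub>R v \<in> W" using W(1) uW vW by (intro subspace_diff subspace_scale)
      show "zonal (b *\<^sub>R u - a *\<^sub>R v)"
        using u(2) v(2) by (simp add: zonal_def linear_diff[OF linear_act] act_scaleR)
    qed (simp add: a_def b_def)
    moreover have "v \<bullet> u = 0" using v(1) u(1) by (simp add: V_def)
    ultimately have "b * (u \<bullet> u) = 0"
      by (metis eq_iff_diff_eq_0 inner_scaleR_left mult_zero_right)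
    then show False using \<open>b \<noteq> 0\<close> u(3) by simp
  qed
qed

section \<open>Invariance of the pieces\<close>

lemma SO3_invariant_mat_tensor:
  assumes "\<And>g M. g \<in> SO3 \<Longrightarrow> M \<in> K \<Longrightarrow> g ** M ** transpose g \<in> K"
  shows "SO3_invariant (mat_tensor a b ` K)"
  using assms by (auto simp: SO3_invariant_def act_mat_tensor)

lemma conj_sym_traceless: "g \<in> SO3 \<Longrightarrow> M \<in> sym_traceless \<Longrightarrow> g ** M ** transpose g \<in> sym_traceless"
  by (simp add: sym_traceless_def conj_sym_matrices trace_conj)

lemma conj_span_mat_1:
  assumes "g \<in> SO3" "M \<in> span {mat 1}"
  shows "g ** M ** transpose g \<in> span {mat 1}"
proof -
  obtain c where "M = c *\<^sub>R mat 1" using assms(2) by (auto simp: span_singleton)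
  then have "g ** M ** transpose g = c *\<^sub>R (g ** mat 1 ** transpose g)"
    by (simp add: matrix_scalar_ac scalar_matrix_assoc flip: scalar_mult_eq_scaleR)
  then show ?thesis by (simp only: conj_mat_1[OF assms(1)]) (simp add: span_scale span_base)
qed

text \<open>The trace matrix \<open>V\<close> of the rotated tensor is tested against itself:
  \<open>mat_tensor 1 1 V\<close> paired with \<open>act g T\<close> is six times the square of
  \<open>V\<close>, while moving the rotation to the other factor pairs \<open>T\<close> with a
  tensor of the same kind, which gives 0.\<close>

lemma SO3_invariant_traceless: "SO3_invariant traceless_sym_space"
  unfolding SO3_invariant_def
proof (intro ballI)
  fix g T assume g: "g \<in> SO3" and T: "T \<in> traceless_sym_space"
  define V where "V = (\<chi> i j. S_trace2 (act g T) i j)"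
  have gT: "act g T \<in> sym_space"
    using T by (intro SO3_invariantD[OF SO3_invariant_sym_space g]) (simp add: traceless_sym_space_def)
  have V: "V \<in> sym_matrices"
    using sym_spaceD(1)[OF gT] by (simp add: V_def sym_matrices_def S_trace2_def)
  have "mat_tensor 1 1 V \<bullet> act g T = act g T \<bullet> mat_tensor 1 1 V" by (rule inner_commute)
  also have "\<dots> = T \<bullet> mat_tensor 1 1 (transpose g ** V ** g)"
    by (simp add: act_adjoint act_mat_tensor[OF SO3_transpose[OF g]])
  also have "\<dots> = 0"
    using inner_traceless[OF conj_sym_matrices[OF V, of "transpose g"] T] by (simp add: inner_commute)
  finally have "(\<Sum>i\<in>UNIV. \<Sum>j\<in>UNIV. V $ i $ j * V $ i $ j) = 0"
    using inner_mat_tensor_sym_space[OF gT, of 1 1 V] by (simp add: V_def)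
  then have "V \<bullet> V = 0" by (simp add: inner_vec_def)
  then have "V = 0" by simp
  then show "act g T \<in> traceless_sym_space"
    using gT by (simp add: traceless_sym_space_def V_def vec_eq_iff)
qed

lemma SO3_invariant_piece_space: "I \<in> {1..5} \<Longrightarrow> SO3_invariant (piece_space I)"
  unfolding atLeastAtMost_1_5
  by (auto simp: piece_space_1 piece_space_2 piece_space_3 piece_space_4 piece_space_5
      SO3_invariant_traceless intro!: SO3_invariant_mat_tensor conj_span_mat_1 conj_sym_traceless)

lemma piece_space_nonzero:
  assumes "I \<in> {1..5}"
  shows "piece_space I \<noteq> {0}"
proof
  assume "piece_space I = {0}"
  then have "dim (piece_space I) = 0" by simp
  moreover have "I = 1 \<or> I = 2 \<or> I = 3 \<or> I = 4 \<or> I = 5"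
    using assms unfolding atLeastAtMost_1_5 by simp
  ultimately show False
    using dim_piece_space_1 dim_piece_space_2 dim_piece_space_3 dim_piece_space_4 dim_piece_space_5
    by (elim disjE) simp_all
qed

section \<open>Irreducibility of the pieces\<close>

lemma irreducible_piece_space_1: "SO3_irreducible (piece_space 1)"
proof (rule SO3_irreducibleI_zonal)
  fix T assume "T \<in> piece_space 1" "T $ 3 $ 3 $ 3 $ 3 = 0"
  then show "T = 0"
    by (auto simp: piece_space_1 span_singleton mat_tensor_nth mat_1_nth kronecker_def vec_eq_iff)
qed (simp_all add: subspace_piece_space SO3_invariant_piece_space piece_space_subset_sym piece_space_nonzero)

lemma irreducible_piece_space_2: "SO3_irreducible (piece_space 2)"
proof (rule SO3_irreducibleI_zonal)
  fix T assume T2: "T \<in> piece_space 2" and z: "zonal T" and 0: "T $ 3 $ 3 $ 3 $ 3 = 0"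
  have T: "T \<in> sym_space" using T2 piece_space_subset_sym[of 2] by auto
  obtain M where M: "M \<in> sym_traceless" and TM: "T = mat_tensor 1 1 M"
    using T2 unfolding piece_space_2 by blast
  then have s: "M \<in> sym_matrices" and tr: "M $ 1 $ 1 + M $ 2 $ 2 + M $ 3 $ 3 = 0"
    by (simp_all add: sym_traceless_def trace_def sum_3)
  have 3: "M $ 3 $ 3 = 0"
    using 0 by (simp add: TM mat_tensor_nth kronecker_def)
  \<comment> \<open>Up to a factor, 1233, 1333 and 2333 of \<open>T\<close> are the off-diagonal
    entries of \<open>M\<close>; the equality of 2233 and 1133 compares two diagonal
    entries.\<close>
  have 4: "M $ 1 $ 2 = 0" "M $ 1 $ 3 = 0" "M $ 2 $ 3 = 0" "M $ 1 $ 1 = M $ 2 $ 2"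
    using zonal_components(9-)[OF T z] 3 unfolding TM by (simp_all add: mat_tensor_nth kronecker_def)
  have "M = 0"
    using tr 3 4 sym_matricesD[OF s, of 1 2] sym_matricesD[OF s, of 1 3] sym_matricesD[OF s, of 2 3]
    by (simp add: vec_eq_iff forall_3)
  then show "T = 0" by (simp add: TM linear_0[OF linear_mat_tensor])
qed (simp_all add: subspace_piece_space SO3_invariant_piece_space piece_space_subset_sym piece_space_nonzero)

lemma irreducible_piece_space_3: "SO3_irreducible (piece_space 3)"
proof (rule SO3_irreducibleI_zonal)
  fix T assume T3: "T \<in> piece_space 3" and z: "zonal T" and 0: "T $ 3 $ 3 $ 3 $ 3 = 0"
  then have T: "T \<in> sym_space" and tr: "S_trace2 T i j = 0" for i j
    by (simp_all add: piece_space_3 traceless_sym_space_def)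
  note zc = zonal_components[OF T z]
  \<comment> \<open>The 33 trace is twice 1133 plus 3333, and the 11 trace is four times 1122 plus
    1133; so 3333 determines the two other free components.\<close>
  have 1: "T $ 1 $ 1 $ 3 $ 3 = 0"
    using tr[of 3 3] 0 zc(10) by (simp add: S_trace2_def sum_3 sym_spaceD[OF T])
  then have "T $ 1 $ 1 $ 2 $ 2 = 0"
    using tr[of 1 1] zc(1) by (simp add: S_trace2_def sum_3 sym_spaceD[OF T])
  then show "T = 0"
    using zc 0 1 by (intro sym_space_eq_0I[OF T]) simp_all
qed (simp_all add: subspace_piece_space SO3_invariant_piece_space piece_space_subset_sym piece_space_nonzero)

text \<open>The map taking \<^term>\<open>mat_tensor 1 1 M\<close> to \<^term>\<open>mat_tensor 2 (- 1) M\<close> is an equivariant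
  isomorphism.\<close>

lemma SO3_irreducible_mat_tensor:
  assumes irr: "SO3_irreducible (mat_tensor 1 1 ` K)" and K: "subspace K" "K \<subseteq> sym_matrices"
    and conj: "\<And>g M. g \<in> SO3 \<Longrightarrow> M \<in> K \<Longrightarrow> g ** M ** transpose g \<in> K"
  shows "SO3_irreducible (mat_tensor 2 (- 1) ` K)"
proof -
  have inj: "inj_on (mat_tensor 1 1) K" "inj_on (mat_tensor 2 (- 1)) K"
    by (rule inj_on_subset[OF inj_on_mat_tensor K(2)]; simp)+
  have 0: "mat_tensor a b 0 = 0" for a b by (rule linear_0[OF linear_mat_tensor])
  have "U = {0} \<or> U = mat_tensor 2 (- 1) ` K"
    if U: "subspace U" "U \<subseteq> mat_tensor 2 (- 1) ` K" "SO3_invariant U" for U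
  proof -
    \<comment> \<open>\<open>U\<close> is pulled back to matrices; irreducibility is then applied to
      the image of \<open>L\<close> with the weights (1, 1).\<close>
    define L where "L = {M \<in> K. mat_tensor 2 (- 1) M \<in> U}"
    have UL: "U = mat_tensor 2 (- 1) ` L" using U(2) by (auto simp: L_def)
    have "subspace L"
      using K(1) U(1)
      by (simp add: L_def subspace_def 0 linear_add[OF linear_mat_tensor] linear_scale[OF linear_mat_tensor])
    moreover have "SO3_invariant (mat_tensor 1 1 ` L)"
      using U(3) conj by (intro SO3_invariant_mat_tensor) (simp add: L_def SO3_invariant_def flip: act_mat_tensor)
    moreover have "L \<subseteq> K" by (auto simp: L_def)
    ultimately have "mat_tensor 1 1 ` L = {0} \<or> mat_tensor 1 1 ` L = mat_tensor 1 1 ` K"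
      using irr linear_subspace_image[OF linear_mat_tensor] unfolding SO3_irreducible_def by blast
    then have "L = {0} \<or> L = K"
    proof
      assume "mat_tensor 1 1 ` L = {0}"
      also have "{0} = mat_tensor 1 1 ` {0}" by (simp add: 0)
      finally show ?thesis
        using inj_on_image_eq_iff[OF inj(1) \<open>L \<subseteq> K\<close>, of "{0}"] subspace_0[OF K(1)] by simp
    next
      assume "mat_tensor 1 1 ` L = mat_tensor 1 1 ` K"
      then show ?thesis
        using inj_on_image_eq_iff[OF inj(1) \<open>L \<subseteq> K\<close>, of K] by simp
    qed
    then show ?thesis by (auto simp: UL 0)
  qed
  moreover have "mat_tensor 2 (- 1) ` K \<noteq> {0}"
  proof
    assume "mat_tensor 2 (- 1) ` K = {0}"
    then have "K = {0}"
      using inj_on_image_eq_iff[OF inj(2) order_refl, of "{0}"] subspace_0[OF K(1)] by (simp add: 0)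
    then show False using irr by (simp add: SO3_irreducible_def 0)
  qed
  ultimately show ?thesis
    unfolding SO3_irreducible_def
    using linear_subspace_image[OF linear_mat_tensor K(1)] SO3_invariant_mat_tensor[OF conj] by blast
qed

lemma irreducible_piece_space: "I \<in> {1..5} \<Longrightarrow> SO3_irreducible (piece_space I)"
proof -
  have "SO3_irreducible (piece_space 4)"
    using irreducible_piece_space_1 unfolding piece_space_1 piece_space_4
    by (rule SO3_irreducible_mat_tensor) (simp_all add: span_mat_1_subset conj_span_mat_1)
  moreover have "SO3_irreducible (piece_space 5)"
    using irreducible_piece_space_2 unfolding piece_space_2 piece_space_5
    by (rule SO3_irreducible_mat_tensor)
      (simp_all add: subspace_sym_traceless sym_traceless_subset conj_sym_traceless)
  ultimately show "I \<in> {1..5} \<Longrightarrow> SO3_irreducible (piece_space I)"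
    using irreducible_piece_space_1 irreducible_piece_space_2 irreducible_piece_space_3
    unfolding atLeastAtMost_1_5 by blast
qed

subsection \<open>Uniqueness\<close>

text \<open>Half of Schur's lemma, in dimensions: \<open>U \<inter> P\<close> is invariant and,
  because of \<open>u\<close> and \<open>w\<close>, not all of \<open>U\<close>, hence zero. So
  \<open>U\<close> and the orthogonal complement \<open>P\<close> of \<open>W\<close> together fit
  into the whole space.\<close>

lemma irreducible_dim_le:
  assumes U: "SO3_irreducible U" and W: "SO3_irreducible W" and uw: "u \<in> U" "w \<in> W" "u \<bullet> w \<noteq> 0"
  shows "dim U \<le> dim W"
proof -
  define P where "P = {v. \<forall>w\<in>W. v \<bullet> w = 0}"
  have sub: "subspace U" "subspace W" "subspace P" "SO3_invariant U" "SO3_invariant W"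
    using U W subspace_orthogonal by (auto simp: SO3_irreducible_def P_def)
  have "subspace (U \<inter> P)" "SO3_invariant (U \<inter> P)"
    using sub SO3_invariant_orthogonal[of W]
    by (auto simp: subspace_inter P_def intro: SO3_invariant_Int)
  moreover have "U \<inter> P \<noteq> U" using uw by (auto simp: P_def)
  ultimately have UP: "U \<inter> P = {0}"
    using U unfolding SO3_irreducible_def by blast
  have "P = {y \<in> UNIV. \<forall>x\<in>W. orthogonal x y}"
    by (auto simp: P_def orthogonal_def inner_commute)
  then have "dim P + dim W = dim (UNIV :: tensor4 set)"
    using dim_subspace_orthogonal_to_vectors[OF sub(2) subspace_UNIV] by simp
  moreover have "dim {x + y |x y. x \<in> U \<and> y \<in> P} + dim (U \<inter> P) = dim U + dim P"
    by (rule dim_sums_Int[OF sub(1,3)])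
  moreover have "dim {x + y |x y. x \<in> U \<and> y \<in> P} \<le> dim (UNIV :: tensor4 set)"
    by (rule dim_subset) simp
  ultimately show ?thesis using UP by simp
qed

lemma irreducible_dim_eq:
  assumes "SO3_irreducible U" "SO3_irreducible W" "u \<in> U" "w \<in> W" "u \<bullet> w \<noteq> 0"
  shows "dim U = dim W"
  using irreducible_dim_le[OF assms(1,2), of u w] irreducible_dim_le[OF assms(2,1), of w u] assms(3-)
  by (simp add: inner_commute)

lemma irreducible_eq_piece_space:
  assumes U: "SO3_irreducible U" "U \<subseteq> V" and ds: "internal_direct_sum J piece_space V"
    and J: "J \<subseteq> {1..5}" and inj: "inj_on (\<lambda>j. dim (piece_space j)) J"
  obtains j where "j \<in> J" "U = piece_space j"
proof -
  have fin: "finite J" and V: "V = {(\<Sum>i\<in>J. w i) | w. \<forall>i\<in>J. w i \<in> piece_space i}"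
    using ds unfolding internal_direct_sum_def by blast+
  have "U \<noteq> {0}" "subspace U" "SO3_invariant U" using U by (simp_all add: SO3_irreducible_def)
  then obtain u where u: "u \<in> U" "u \<noteq> 0" using subspace_0 by blast
  then obtain w where w: "\<forall>i\<in>J. w i \<in> piece_space i" "u = (\<Sum>i\<in>J. w i)"
    using U(2) unfolding V by blast
  have "(\<Sum>i\<in>J. u \<bullet> w i) \<noteq> 0"
    using u(2) by (simp add: w(2) flip: inner_sum_right)
  then obtain j where j: "j \<in> J" "u \<bullet> w j \<noteq> 0" by (meson sum.neutral)
  have dj: "dim U = dim (piece_space j)"
    using irreducible_dim_eq[OF U(1) irreducible_piece_space u(1) _ j(2)] j(1) J w(1) by blast
  have orth: "x \<bullet> y = 0" if "i \<in> J" "i \<noteq> j" "x \<in> U" "y \<in> piece_space i" for i x y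
    using irreducible_dim_eq[OF U(1) irreducible_piece_space that(3,4)] dj inj that(1,2) j(1) J
    unfolding inj_on_def by (metis subsetD)
  have "U \<subseteq> piece_space j"
  proof
    fix x assume x: "x \<in> U"
    then obtain v where v: "\<forall>i\<in>J. v i \<in> piece_space i" "x = (\<Sum>i\<in>J. v i)"
      using U(2) unfolding V by blast
    \<comment> \<open>The product of \<open>x\<close> with \<open>v i\<close> is the square of
      \<open>v i\<close>, as the other summands are orthogonal to it, and it is 0 by
      \<open>orth\<close>.\<close>
    have "v i = 0" if i: "i \<in> J" "i \<noteq> j" for i
    proof -
      have "0 = x \<bullet> v i" using orth[OF i x] v(1) i(1) by simp
      also have "\<dots> = (\<Sum>k\<in>J. v k \<bullet> v i)" by (simp add: v(2) inner_sum_left)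
      also have "\<dots> = (\<Sum>k\<in>J. if k = i then v i \<bullet> v i else 0)"
      proof (intro sum.cong refl)
        fix k assume k: "k \<in> J"
        show "v k \<bullet> v i = (if k = i then v i \<bullet> v i else 0)"
          using piece_space_orthogonal[of k i "v k" "v i"] v(1) k i(1) J by (auto simp del: atLeastAtMost_iff)
      qed
      also have "\<dots> = v i \<bullet> v i" using fin i(1) by simp
      finally show ?thesis by simp
    qed
    then have "x = (\<Sum>i\<in>J. if i = j then v j else 0)"
      unfolding v(2) by (intro sum.cong) auto
    then show "x \<in> piece_space j" using fin j(1) v(1) by simp
  qed
  then have "U = piece_space j"
    using irreducible_piece_space[of j] \<open>U \<noteq> {0}\<close> \<open>subspace U\<close> \<open>SO3_invariant U\<close> j(1) J
    unfolding SO3_irreducible_def by blast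
  then show thesis using that j(1) by blast
qed

lemma irreducible_SA_eq_piece_space:
  assumes U: "SO3_irreducible U" "U \<subseteq> sym_space \<or> U \<subseteq> asym_space"
  shows "\<exists>j\<in>{1..5}. U = piece_space j"
  using U(2)
proof
  assume "U \<subseteq> sym_space"
  then show ?thesis
    by (rule irreducible_eq_piece_space[OF U(1) _ internal_direct_sum_sym])
      (auto simp: dim_piece_space_1 dim_piece_space_2 dim_piece_space_3)
next
  assume "U \<subseteq> asym_space"
  then show ?thesis
    by (rule irreducible_eq_piece_space[OF U(1) _ internal_direct_sum_asym])
      (auto simp: dim_piece_space_4 dim_piece_space_5)
qed

lemma decomposition_unique:
  assumes "irreducible_SA_decomposition n W"
  shows "\<exists>\<pi>. bij_betw \<pi> {1..n} {1..5} \<and> (\<forall>i\<in>{1..n}. W i = piece_space (\<pi> i))"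
proof -
  have sums: "elasticity = {(\<Sum>i\<in>{1..n}. w i) | w. \<forall>i\<in>{1..n}. w i \<in> W i}"
    and direct: "\<And>w. (\<forall>i\<in>{1..n}. w i \<in> W i) \<Longrightarrow> (\<Sum>i\<in>{1..n}. w i) = 0 \<Longrightarrow> \<forall>i\<in>{1..n}. w i = 0"
    and irr: "\<And>i. i \<in> {1..n} \<Longrightarrow> SO3_irreducible (W i) \<and> (W i \<subseteq> sym_space \<or> W i \<subseteq> asym_space)"
    using assms unfolding irreducible_SA_decomposition_def internal_direct_sum_def by blast+
  have "\<forall>i\<in>{1..n}. \<exists>j\<in>{1..5}. W i = piece_space j"
    using irr irreducible_SA_eq_piece_space by blast
  then obtain \<pi> where \<pi>: "\<And>i. i \<in> {1..n} \<Longrightarrow> \<pi> i \<in> {1..5} \<and> W i = piece_space (\<pi> i)"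
    by metis
  have "inj_on \<pi> {1..n}"
  proof (rule inj_onI, rule ccontr)
    fix i k assume ik: "i \<in> {1..n}" "k \<in> {1..n}" "\<pi> i = \<pi> k" "i \<noteq> k"
    then have W: "W i = W k" using \<pi> by metis
    have sub: "subspace (W m)" if "m \<in> {1..n}" for m
      using irr[OF that] by (simp add: SO3_irreducible_def)
    have "W i \<noteq> {0}" using irr[OF ik(1)] by (simp add: SO3_irreducible_def)
    then obtain x where x: "x \<in> W i" "x \<noteq> 0" using subspace_0[OF sub[OF ik(1)]] by blast
    \<comment> \<open>If two summands coincide, \<open>x\<close> in one and \<open>- x\<close> in
      the other is a nontrivial representation of 0.\<close>
    define w where "w m = (if m = i then x else 0) + (if m = k then - x else 0)" for m
    have "0 \<in> W m" if "m \<in> {1..n}" for m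
      by (rule subspace_0[OF sub[OF that]])
    then have "\<forall>m\<in>{1..n}. w m \<in> W m"
      using x(1) ik(4) W subspace_neg[OF sub[OF ik(2)]] by (auto simp: w_def simp del: atLeastAtMost_iff)
    moreover have "(\<Sum>m\<in>{1..n}. w m) = 0"
      unfolding w_def sum.distrib using ik(1,2) by simp
    ultimately have "w i = 0" using direct ik(1) by blast
    then show False using x(2) ik(4) by (simp add: w_def)
  qed
  \<comment> \<open>A piece missed by \<open>\<pi>\<close> would be orthogonal to every summand,
    hence to all of \<open>elasticity\<close> and to itself.\<close>
  moreover have "J \<in> \<pi> ` {1..n}" if J: "J \<in> {1..5}" for J
  proof (rule ccontr)
    assume nJ: "J \<notin> \<pi> ` {1..n}"
    obtain x where x: "x \<in> piece_space J" "x \<noteq> 0"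
      using piece_space_nonzero[OF J] subspace_0[OF subspace_piece_space[OF J]] by blast
    then have "x \<in> elasticity" using piece_space_subset[OF J] by blast
    then obtain w where w: "\<forall>i\<in>{1..n}. w i \<in> W i" "x = (\<Sum>i\<in>{1..n}. w i)"
      unfolding sums by blast
    have "w i \<bullet> x = 0" if i: "i \<in> {1..n}" for i
    proof (rule piece_space_orthogonal[OF _ J _ _ x(1)])
      show "\<pi> i \<in> {1..5}" "w i \<in> piece_space (\<pi> i)" using \<pi>[OF i] w(1) i by auto
      show "\<pi> i \<noteq> J" using nJ i by blast
    qed
    then have "x \<bullet> x = 0" by (subst w(2)) (simp add: inner_sum_left)
    then show False using x(2) by simp
  qed
  ultimately have "bij_betw \<pi> {1..n} {1..5}"
    using \<pi> unfolding bij_betw_def by blast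
  then show ?thesis using \<pi> by blast
qed

lemma inner_pieces_self:
  assumes C: "C \<in> elasticity"
  shows "C \<bullet> C = (\<Sum>I\<in>{1..5}. piece I C \<bullet> piece I C)"
proof -
  have "C \<bullet> C = (\<Sum>I\<in>{1..5}. \<Sum>J\<in>{1..5}. piece I C \<bullet> piece J C)"
    by (subst (1 2) sum_pieces[OF C]) (simp add: inner_sum_left inner_sum_right, rule sum.swap)
  also have "\<dots> = (\<Sum>I\<in>{1..5}. \<Sum>J\<in>{1..5}. if J = I then piece I C \<bullet> piece I C else 0)"
    using piece_space_orthogonal piece_in[OF C] by (intro sum.cong refl) auto
  finally show ?thesis by simp
qed

theorem theorem1:
  shows
    "((\<forall>I\<in>{1..5}. subspace (piece_space I) \<and> piece_space I \<subseteq> elasticity) \<and>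
      (\<forall>C\<in>elasticity. \<forall>i j k l.
         C $ i $ j $ k $ l = (\<Sum>I=1..5. piece I C $ i $ j $ k $ l) \<and>
         (\<Sum>I=1..5. piece I C $ i $ j $ k $ l) =
           (S1 (S_part C) $ i $ j $ k $ l + S2 (S_part C) $ i $ j $ k $ l + S3 (S_part C) $ i $ j $ k $ l)
           + (A1 (A_part C) $ i $ j $ k $ l + A2 (A_part C) $ i $ j $ k $ l)))
     \<and>
     (internal_direct_sum {1..5} piece_space elasticity \<and>
      internal_direct_sum {1, 2} (\<lambda>m::nat. if m = 1 then sym_space else asym_space) elasticity \<and>
      internal_direct_sum {1, 2, 3} piece_space sym_space \<and>
      internal_direct_sum {4, 5} piece_space asym_space \<and>
      dim elasticity = 21 \<and> dim sym_space = 1 + 5 + 9 \<and> dim asym_space = 1 + 5 \<and>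
      dim (piece_space 1) = 1 \<and> dim (piece_space 2) = 5 \<and> dim (piece_space 3) = 9 \<and>
      dim (piece_space 4) = 1 \<and> dim (piece_space 5) = 5)
     \<and>
     ((\<forall>I\<in>{1..5}. SO3_invariant (piece_space I) \<and> SO3_irreducible (piece_space I)) \<and>
      irreducible_SA_decomposition 5 piece_space \<and>
      (\<forall>n W. irreducible_SA_decomposition n W \<longrightarrow>
         (\<exists>\<pi>. bij_betw \<pi> {1..n} {1..5} \<and> (\<forall>i\<in>{1..n}. W i = piece_space (\<pi> i)))))
     \<and>
     (\<forall>C\<in>elasticity. \<forall>I\<in>{1..5}. \<forall>J\<in>{1..5}. I \<noteq> J \<longrightarrow> piece I C \<bullet> piece J C = 0)
     \<and>
     (\<forall>C\<in>elasticity.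
        C \<bullet> C = (piece 1 C \<bullet> piece 1 C + piece 2 C \<bullet> piece 2 C + piece 3 C \<bullet> piece 3 C)
              + (piece 4 C \<bullet> piece 4 C + piece 5 C \<bullet> piece 5 C))"
proof (intro conjI)
  show "\<forall>I\<in>{1..5}. subspace (piece_space I) \<and> piece_space I \<subseteq> elasticity"
    using subspace_piece_space piece_space_subset by blast
  show "\<forall>C\<in>elasticity. \<forall>i j k l.
      C $ i $ j $ k $ l = (\<Sum>I=1..5. piece I C $ i $ j $ k $ l) \<and>
      (\<Sum>I=1..5. piece I C $ i $ j $ k $ l) =
        (S1 (S_part C) $ i $ j $ k $ l + S2 (S_part C) $ i $ j $ k $ l + S3 (S_part C) $ i $ j $ k $ l)
        + (A1 (A_part C) $ i $ j $ k $ l + A2 (A_part C) $ i $ j $ k $ l)"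
  proof (intro ballI allI conjI)
    fix C i j k l
    assume C: "C \<in> elasticity"
    show "C $ i $ j $ k $ l = (\<Sum>I=1..5. piece I C $ i $ j $ k $ l)"
      by (subst sum_pieces[OF C]) (simp add: sum_component)
    show "(\<Sum>I=1..5. piece I C $ i $ j $ k $ l) =
        (S1 (S_part C) $ i $ j $ k $ l + S2 (S_part C) $ i $ j $ k $ l + S3 (S_part C) $ i $ j $ k $ l)
        + (A1 (A_part C) $ i $ j $ k $ l + A2 (A_part C) $ i $ j $ k $ l)"
      unfolding atLeastAtMost_1_5 by (simp add: piece_def)
  qed
  show "internal_direct_sum {1..5} piece_space elasticity"
    by (rule internal_direct_sum_elasticity)
  show "internal_direct_sum {1, 2} (\<lambda>m::nat. if m = 1 then sym_space else asym_space) elasticity"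
    by (rule internal_direct_sum_SA)
  show "internal_direct_sum {1, 2, 3} piece_space sym_space"
    by (rule internal_direct_sum_sym)
  show "internal_direct_sum {4, 5} piece_space asym_space"
    by (rule internal_direct_sum_asym)
  show "dim elasticity = 21" by (rule dim_elasticity)
  show "dim sym_space = 1 + 5 + 9" by (simp add: dim_sym_space)
  show "dim asym_space = 1 + 5" by (simp add: dim_asym_space)
  show "dim (piece_space 1) = 1" "dim (piece_space 2) = 5" "dim (piece_space 3) = 9"
    "dim (piece_space 4) = 1" "dim (piece_space 5) = 5"
    by (rule dim_piece_space_1 dim_piece_space_2 dim_piece_space_3 dim_piece_space_4 dim_piece_space_5)+
  show "\<forall>I\<in>{1..5}. SO3_invariant (piece_space I) \<and> SO3_irreducible (piece_space I)"
    using SO3_invariant_piece_space irreducible_piece_space by blast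
  have "piece_space i \<subseteq> sym_space \<or> piece_space i \<subseteq> asym_space" if "i \<in> {1..5}" for i
    using that piece_space_subset_sym[of i] piece_space_subset_asym[of i]
    unfolding atLeastAtMost_1_5 by blast
  then show "irreducible_SA_decomposition 5 piece_space"
    unfolding irreducible_SA_decomposition_def
    using internal_direct_sum_elasticity irreducible_piece_space by blast
  show "\<forall>n W. irreducible_SA_decomposition n W \<longrightarrow>
      (\<exists>\<pi>. bij_betw \<pi> {1..n} {1..5} \<and> (\<forall>i\<in>{1..n}. W i = piece_space (\<pi> i)))"
    using decomposition_unique by blast
  show "\<forall>C\<in>elasticity. \<forall>I\<in>{1..5}. \<forall>J\<in>{1..5}. I \<noteq> J \<longrightarrow> piece I C \<bullet> piece J C = 0"
    by (intro ballI impI) (rule piece_space_orthogonal, assumption+, (erule piece_in)+)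
  show "\<forall>C\<in>elasticity.
      C \<bullet> C = (piece 1 C \<bullet> piece 1 C + piece 2 C \<bullet> piece 2 C + piece 3 C \<bullet> piece 3 C)
            + (piece 4 C \<bullet> piece 4 C + piece 5 C \<bullet> piece 5 C)"
    unfolding inner_pieces_self atLeastAtMost_1_5
    by (intro ballI) (simp add: inner_pieces_self[unfolded atLeastAtMost_1_5])
qed

end
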